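(* Let $\mathbb{A}\subset\mathbb{C}$ be a non-empty connected open set, let $\psi$ satisfy Assumption 1 (see context), and let $H\in\mathcal{H}_2(\bar{\mathbb{A}}^{\mathsf{c}})$ be the transfer function of the full order model. Let $\psi'(\cdot)^{\frac12}$ be analytic in $\mathbb{X}$ and have the poles $\{\gamma_\ell\}_{\ell=1}^m$, with $\psi(\gamma_\ell)\in\bar{\mathbb{A}}^{\mathsf{c}}$ for $\ell=1,\dots,m$. Let $\widehat{H}\in\mathcal{H}_2(\bar{\mathbb{A}}^{\mathsf{c}})$, a reduced transfer function of order $r$ with simple poles $\widehat{\lambda}_1,\dots,\widehat{\lambda}_r\in\mathbb{A}$, be a local minimizer of $\min_{\tilde H}\|H-\tilde H\|_{\mathcal{H}_2(\bar{\mathbb{A}}^{\mathsf{c}})}$, where $\tilde H$ ranges over transfer functions of reduced order models of dimension $r$. Let the points $\psi^{-1}(\widehat{\lambda}_j)$, $j=1,\dots,r$, be different from the poles of $\psi'(\cdot)^{\frac12}$ and of $\psi$. Let, in addition, $\psi$ and $\psi'(\cdot)^{\frac12}$ have the same poles, and assume that for $j=1,\dots,r$ the derivative $\overline{\psi'}$ exists and is nonzero in a neighborhood of the point $-\psi^{-1}(\widehat{\lambda}_j)$ (equivalently, $\psi'$ exists and is nonzero in a neighborhood of $-\psi^{-1}(\widehat{\lambda}_j)^*$). Then the first order necessary optimality conditions $\mathfrak{F}_{\widehat{H}}(\widehat{\lambda}_j)=\mathfrak{F}_{H}(\widehat{\lambda}_j)$ and $\mathfrak{F}_{\widehat{H}}'(\widehat{\lambda}_j)=\mathfrak{F}_{H}'(\widehat{\lambda}_j)$,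 $j=1,\dots,r$, satisfied by $\widehat H$ become $$\widehat{H}(\varphi(\widehat{\lambda}_j))=H(\varphi(\widehat{\lambda}_j))\quad\text{and}\quad\widehat{H}'(\varphi(\widehat{\lambda}_j))=H'(\varphi(\widehat{\lambda}_j)),\qquad j=1,\dots,r,$$ where $\varphi(s)=\overline{\psi}(-\psi^{-1}(s))^*$.
   Context: Notation: $(\cdot)^*$ is complex conjugation of scalars (Hermitian transpose of matrices and vectors). $\mathbb{C}_+$ and $\mathbb{C}_-$ are the open right and left half planes. For an open set $\mathbb{Y}\subset\mathbb{C}$, $\bar{\mathbb{Y}}^{\mathsf{c}}=\mathbb{C}\setminus(\mathbb{Y}\cup\delta\mathbb{Y})$ is its exterior ($\delta\mathbb{Y}$ the boundary). For a function $f$, $\overline{f}(s)=f(s^* )^*$; thus $\varphi(s)=\psi(-\psi^{-1}(s)^* )$. $\mathsf{res}[f(s),\lambda]$ is the residue of $f$ at $\lambda$. Assumption 1: $\psi\colon\mathbb{C}\to\mathbb{C}$ is meromorphic; $\psi\colon\mathbb{X}\to\mathbb{A}$, with $\mathbb{X}\subseteq\mathbb{C}_-$ open, is bijective conformal; there is an open subset $\tilde{\mathbb{X}}\subseteq\bar{\mathbb{X}}^{\mathsf{c}}$ with $\{s\in\mathbb{C}\mid -s^*\in\mathbb{X}\}\subseteq\tilde{\mathbb{X}}$ such that $\psi$ maps $\tilde{\mathbb{X}}$ conformally into $\bar{\mathbb{A}}^{\mathsf{c}}$; and $\psi'$ is zero at only finitely many points of $\bar{\mathbb{X}}^{\mathsf{c}}$.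 Here a map is conformal on an open set if it is analytic with nowhere vanishing derivative there. $\psi^{-1}\colon\mathbb{A}\to\mathbb{X}$ is the inverse of $\psi|_{\mathbb{X}}$. $\psi'(\cdot)^{\frac12}$ denotes a fixed square root of $\psi'$. Hardy spaces: $\mathcal{H}_2(\mathbb{C}_+)$ is the set of analytic $h\colon\mathbb{C}_+\to\mathbb{C}$ with $\sup_{x>0}\int_{-\infty}^\infty|h(x+\mathrm{i}\omega)|^2\,\mathrm{d}\omega<\infty$, with inner product $\langle h,g\rangle_{\mathcal{H}_2(\mathbb{C}_+)}=\frac{1}{2\pi}\int_{-\infty}^\infty h(\mathrm{i}\omega)^*g(\mathrm{i}\omega)\,\mathrm{d}\omega$. For $f\colon\bar{\mathbb{A}}^{\mathsf{c}}\to\mathbb{C}$ analytic, put $\mathfrak{H}_f(s)=f(\psi(s))\psi'(s)^{\frac12}$, $\langle f,g\rangle_{\mathcal{H}_2(\bar{\mathbb{A}}^{\mathsf{c}})}=\langle\mathfrak{H}_f,\mathfrak{H}_g\rangle_{\mathcal{H}_2(\mathbb{C}_+)}$, $\|f\|_{\mathcal{H}_2(\bar{\mathbb{A}}^{\mathsf{c}})}=\|\mathfrak{H}_f\|_{\mathcal{H}_2(\mathbb{C}_+)}$, and $\mathcal{H}_2(\bar{\mathbb{A}}^{\mathsf{c}})$ is the set of analytic $f\colon\bar{\mathbb{A}}^{\mathsf{c}}\to\mathbb{C}$ with finite norm. Moreover $\overline{\mathfrak{H}}_f(-s)=\overline{f}(\overline{\psi}(-s))\,\overline{\psi'}(-s)^{\frac12}$.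 For $F\in\mathcal{H}_2(\bar{\mathbb{A}}^{\mathsf{c}})$ and $\psi'(\cdot)^{\frac12}$ with simple poles $\{\gamma_\ell\}_{\ell=1}^m\subset\mathbb{C}_-$, define $$\mathfrak{F}_F(s)=\overline{\mathfrak{H}}_F(-\psi^{-1}(s))\,\psi'(\psi^{-1}(s))^{-\frac12}+\sum_{\ell=1}^m\overline{\mathfrak{H}}_F(-\gamma_\ell)\frac{\mathsf{res}[\psi'(s)^{\frac12},\gamma_\ell]}{\psi(\gamma_\ell)-s}.$$ When $\psi$ and $\psi'(\cdot)^{\frac12}$ have the same poles (so that $\mathfrak{H}_F$ has the same poles as $F\circ\psi$), this is taken to be $\mathfrak{F}_F(s)=\overline{\mathfrak{H}}_F(-\psi^{-1}(s))\,\psi'(\psi^{-1}(s))^{-\frac12}$, without the sum. Transfer functions: the full order model has transfer function $H(s)=\mathbf{c}^*(s\mathbf{I}-\mathbf{A})^{-1}\mathbf{b}$ with $\mathbf{A}\in\mathbb{C}^{n\times n}$, $\mathbf{b},\mathbf{c}\in\mathbb{C}^n$; a reduced order model of dimension $r$ (with $r<n$) has transfer function $\widehat{\mathbf{c}}_r^*(s\mathbf{I}-\widehat{\mathbf{A}}_r)^{-1}\widehat{\mathbf{b}}_r$ with $\widehat{\mathbf{A}}_r\in\mathbb{C}^{r\times r}$, $\widehat{\mathbf{b}}_r,\widehat{\mathbf{c}}_r\in\mathbb{C}^r$. The rational functions considered have only simple poles, so $\widehat H(s)=\sum_{j=1}^r\frac{\widehat\phi_j}{s-\widehat\lambda_j}$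 with $\widehat\phi_j\neq0$ and distinct $\widehat\lambda_j$. $\widehat H$ is a local minimizer if $\|H-\widehat H\|_{\mathcal{H}_2(\bar{\mathbb{A}}^{\mathsf{c}})}\le\|H-\tilde H\|_{\mathcal{H}_2(\bar{\mathbb{A}}^{\mathsf{c}})}$ for all order-$r$ transfer functions $\tilde H$ sufficiently close to $\widehat H$ in the $\mathcal{H}_2(\bar{\mathbb{A}}^{\mathsf{c}})$-norm.
   Formalization: That the minimizer satisfies the conditions is proved only if, for each μ in A, 1/(s−μ) is in the Hardy space and its transform is analytic on the closed left half plane except at ψ^{-1}(μ) (this forces ψ to be Möbius); the equivalence of the two sets of conditions needs no such premise. *)

theory Defs
  imports "HOL-Complex_Analysis.Complex_Analysis"
begin

section \<open>The conformal setting\<close>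

definition conformal_on :: "(complex \<Rightarrow> complex) \<Rightarrow> complex set \<Rightarrow> bool" where
  "conformal_on f S \<longleftrightarrow> f analytic_on S \<and> (\<forall>s\<in>S. deriv f s \<noteq> 0)"

text \<open>A meromorphic function is represented by a total function (value \<open>0\<close> at its poles, by
  \<^const>\<open>nicely_meromorphic_on\<close>).  The derivative has no meaning at a pole, so poles are left out
  when the zeros of the derivative are counted.\<close>

definition conformal_setting :: "(complex \<Rightarrow> complex) \<Rightarrow> complex set \<Rightarrow> complex set \<Rightarrow> bool" where
  "conformal_setting \<psi> X A \<longleftrightarrow>
     \<psi> nicely_meromorphic_on UNIV \<and>
     open X \<and> X \<subseteq> {s. Re s < 0} \<and>
     conformal_on \<psi> X \<and> bij_betw \<psi> X A \<and>
     (\<exists>Xt. open Xt \<and> Xt \<subseteq> - closure X \<and> {s. - cnj s \<in> X} \<subseteq> Xt \<and>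
           conformal_on \<psi> Xt \<and> \<psi> ` Xt \<subseteq> - closure A) \<and>
     finite {s \<in> - closure X. \<not> is_pole \<psi> s \<and> deriv \<psi> s = 0}"

text \<open>\<open>q\<close> is a fixed square root of \<open>\<psi>'\<close>.  No analyticity is built in: outside of \<open>X\<close>
  the root may have branch cuts.\<close>

definition sqrt_deriv :: "(complex \<Rightarrow> complex) \<Rightarrow> (complex \<Rightarrow> complex) \<Rightarrow> bool" where
  "sqrt_deriv \<psi> q \<longleftrightarrow> (\<forall>s. \<not> is_pole \<psi> s \<longrightarrow> q s ^ 2 = deriv \<psi> s)"

definition simple_pole :: "(complex \<Rightarrow> complex) \<Rightarrow> complex \<Rightarrow> bool" where
  "simple_pole f z \<longleftrightarrow> isolated_singularity_at f z \<and> is_pole f z \<and> zorder f z = -1"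

text \<open>\<open>\<psi> z\<close> lies in the exterior of \<open>A\<close>.  At a pole the value is \<open>\<infinity>\<close>, which lies in the
  exterior of \<open>A\<close> (on the Riemann sphere) iff \<open>A\<close> is bounded.\<close>

definition value_in_exterior :: "(complex \<Rightarrow> complex) \<Rightarrow> complex set \<Rightarrow> complex \<Rightarrow> bool" where
  "value_in_exterior \<psi> A z \<longleftrightarrow> (if is_pole \<psi> z then bounded A else \<psi> z \<in> - closure A)"

definition cbar :: "(complex \<Rightarrow> complex) \<Rightarrow> complex \<Rightarrow> complex" where
  "cbar f s = cnj (f (cnj s))"

abbreviation psi_inv :: "(complex \<Rightarrow> complex) \<Rightarrow> complex set \<Rightarrow> complex \<Rightarrow> complex" where
  "psi_inv \<psi> X \<equiv> inv_into X \<psi>"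

definition phi :: "(complex \<Rightarrow> complex) \<Rightarrow> complex set \<Rightarrow> complex \<Rightarrow> complex" where
  "phi \<psi> X s = cnj (cbar \<psi> (- psi_inv \<psi> X s))"


section \<open>Hardy spaces\<close>

definition H2_rhp :: "(complex \<Rightarrow> complex) set" where
  "H2_rhp = {h. h holomorphic_on {s. Re s > 0} \<and>
     (SUP x\<in>{0<..}. \<integral>\<^sup>+ \<omega>. ennreal (cmod (h (Complex x \<omega>)) ^ 2) \<partial>lborel) < \<infinity>}"

text \<open>The value \<open>h(i\<omega>)\<close> of a Hardy space function is its (a.e. existing) boundary limit.\<close>

definition bvalue :: "(complex \<Rightarrow> complex) \<Rightarrow> real \<Rightarrow> complex" where
  "bvalue h \<omega> = Lim (at_right 0) (\<lambda>x. h (Complex x \<omega>))"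

definition H2_rhp_inner :: "(complex \<Rightarrow> complex) \<Rightarrow> (complex \<Rightarrow> complex) \<Rightarrow> complex" where
  "H2_rhp_inner h g = complex_of_real (1 / (2 * pi)) * (LINT \<omega>|lborel. cnj (bvalue h \<omega>) * bvalue g \<omega>)"

definition H2_rhp_norm :: "(complex \<Rightarrow> complex) \<Rightarrow> real" where
  "H2_rhp_norm h = sqrt (Re (H2_rhp_inner h h))"

text \<open>\<open>(f \<circ> \<psi>) q\<close>, where removable singularities at poles of \<open>\<psi>\<close> are filled in: there
  \<open>f \<circ> \<psi>\<close> is the limit of \<open>f\<close> at \<open>\<infinity>\<close>, not the value of \<open>f\<close> at the dummy value of \<open>\<psi>\<close>.\<close>

definition hfrak :: "(complex \<Rightarrow> complex) \<Rightarrow> (complex \<Rightarrow> complex) \<Rightarrow> (complex \<Rightarrow> complex)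
    \<Rightarrow> complex \<Rightarrow> complex" where
  "hfrak \<psi> q f s = (if is_pole \<psi> s then Lim (at s) (\<lambda>z. f (\<psi> z) * q z) else f (\<psi> s) * q s)"

definition H2_ext :: "(complex \<Rightarrow> complex) \<Rightarrow> (complex \<Rightarrow> complex) \<Rightarrow> complex set
    \<Rightarrow> (complex \<Rightarrow> complex) set" where
  "H2_ext \<psi> q A = {f. f holomorphic_on - closure A \<and> hfrak \<psi> q f \<in> H2_rhp}"

definition H2_ext_norm :: "(complex \<Rightarrow> complex) \<Rightarrow> (complex \<Rightarrow> complex) \<Rightarrow> (complex \<Rightarrow> complex) \<Rightarrow> real" where
  "H2_ext_norm \<psi> q f = H2_rhp_norm (hfrak \<psi> q f)"

text \<open>\<open>\<Gamma>\<close> is the set of poles of \<open>q\<close> in the open left half plane.\<close>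

definition frakF :: "(complex \<Rightarrow> complex) \<Rightarrow> (complex \<Rightarrow> complex) \<Rightarrow> complex set \<Rightarrow> complex set
    \<Rightarrow> (complex \<Rightarrow> complex) \<Rightarrow> complex \<Rightarrow> complex" where
  "frakF \<psi> q X \<Gamma> F s =
     cbar (hfrak \<psi> q F) (- psi_inv \<psi> X s) * inverse (q (psi_inv \<psi> X s)) +
     (if {z. is_pole \<psi> z} = {z. is_pole q z} then 0
      else (\<Sum>\<gamma>\<in>\<Gamma>. cbar (hfrak \<psi> q F) (- \<gamma>) * (residue q \<gamma> / (\<psi> \<gamma> - s))))"


section \<open>Transfer functions and local minimizers\<close>

text \<open>\<^const>\<open>remove_sings\<close> turns the formula, which is meaningless at all eigenvalues of the
  matrix, into the rational function it stands for (value \<open>0\<close> at the poles).\<close>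

definition transfer_fun :: "complex^'k^'k \<Rightarrow> complex^'k \<Rightarrow> complex^'k \<Rightarrow> complex \<Rightarrow> complex" where
  "transfer_fun M b c =
     remove_sings (\<lambda>s. \<Sum>i\<in>UNIV. cnj (c $ i) * (matrix_inv (mat s - M) *v b) $ i)"

definition transfer_funs :: "'k::finite itself \<Rightarrow> (complex \<Rightarrow> complex) set" where
  "transfer_funs _ = {G. \<exists>(M :: complex^'k^'k) b c. G = transfer_fun M b c}"

definition local_H2_minimizer :: "(complex \<Rightarrow> complex) \<Rightarrow> (complex \<Rightarrow> complex) \<Rightarrow> complex set
    \<Rightarrow> (complex \<Rightarrow> complex) set \<Rightarrow> (complex \<Rightarrow> complex) \<Rightarrow> (complex \<Rightarrow> complex) \<Rightarrow> bool" where
  "local_H2_minimizer \<psi> q A R H Hr \<longleftrightarrow>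
     Hr \<in> R \<inter> H2_ext \<psi> q A \<and>
     (\<exists>\<epsilon>>0. \<forall>G \<in> R \<inter> H2_ext \<psi> q A. H2_ext_norm \<psi> q (\<lambda>s. G s - Hr s) < \<epsilon> \<longrightarrow>
        H2_ext_norm \<psi> q (\<lambda>s. H s - Hr s) \<le> H2_ext_norm \<psi> q (\<lambda>s. H s - G s))"

text \<open>The facts on which the residue representation \<open>\<langle>F, 1/(\<cdot> - \<mu>)\<rangle> = frakF F \<mu>\<close> rests: the
  elementary fractions with pole in \<open>A\<close> belong to the space, and the only singularity of their
  transforms in the closed left half plane is the one at \<open>\<psi>\<^sup>-\<^sup>1(\<mu>)\<close>.  The conformal setting does not
  imply them, because \<open>\<psi>\<close> may take values in \<open>A\<close> outside of \<open>X\<close>.  For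
  \<open>\<psi> s = (s + 2)^3\<close>, \<open>q s = sqrt 3 * (s + 2)\<close> and \<open>X\<close> the disc of radius \<open>1/2\<close> about \<open>-1\<close>, each point
  of \<open>A\<close> has three preimages in the left half plane, and a best approximation of order 1 to
  \<open>1/(s - 1) + 0.3/(s - 2)\<close> violates the first order conditions expressed by \<open>frakF\<close>.\<close>

definition residue_regular :: "(complex \<Rightarrow> complex) \<Rightarrow> (complex \<Rightarrow> complex) \<Rightarrow> complex set \<Rightarrow> complex set
    \<Rightarrow> bool" where
  "residue_regular \<psi> q X A \<longleftrightarrow>
     (\<forall>\<mu>\<in>A. (\<lambda>s. 1 / (s - \<mu>)) \<in> H2_ext \<psi> q A \<and>
        hfrak \<psi> q (\<lambda>s. 1 / (s - \<mu>)) analytic_on {s. Re s \<le> 0} - {psi_inv \<psi> X \<mu>})"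

end

theory Submission
  imports Defs "HOL-Probability.Sinc_Integral"
begin

text \<open>Write \<open>w\<close> for \<open>- cnj (\<psi>\<^sup>-\<^sup>1 \<lambda>\<^sub>j)\<close>, so that \<open>\<phi> \<lambda>\<^sub>j = \<psi> w\<close>.  As the pole sum drops out, \<open>frakF F \<lambda>\<^sub>j\<close> is, up to a
  nonzero holomorphic factor and conjugation, \<open>hfrak F w\<close>; and the square of the difference of two
  transforms is \<open>(D \<circ> \<psi>)\<^sup>2 \<psi>'\<close> with \<open>D\<close> the difference of the functions.  Hence both sets of conditions
  say that a difference vanishes to second order, and no analyticity of the root \<open>q\<close> near \<open>w\<close> is
  needed.

  Under \<^const>\<open>residue_regular\<close>, \<open>\<psi>\<close> takes each value in \<open>A\<close> only once in the whole plane.  By Liouville's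
  theorem it is then a Moebius transformation, and \<open>q\<close> is a constant divided by its denominator.  The
  transforms of transfer functions are therefore rational, and membership in the Hardy space makes
  them analytic on the closed right half plane and \<open>O(1/s)\<close> at infinity.  The kernels
  \<open>1 / (s - \<psi> p)\<close> turn into multiples of \<open>1 / (s - p)\<close>, which reproduce values by Cauchy's theorem, and varying a
  residue and a pole of the reduced model gives the first order conditions.\<close>

section \<open>Hermite conditions under the conformal transform\<close>

text \<open>Two obstacles shape the argument. The root \<open>q\<close> may change sign from point
  to point outside of \<open>X\<close>, so derivatives are compared through squares, where only the
  derivative of \<open>\<psi>\<close> enters; a sign can be fixed only where the transformed kernel
  \<open>q / (\<psi> - \<mu>)\<close> is known to be continuous. And \<open>bvalue\<close> is a
  pointwise limit, which a general Hardy space function has only almost everywhere; boundary theory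
  is avoided because the transforms that occur are rational and continuous up to the axis. The
  Liouville step rests on the fact that the squared kernel is minus the derivative of
  \<open>1 / (\<psi> - \<mu>)\<close>. At a second solution of \<open>\<psi> = \<mu>\<close>, of
  multiplicity k, that derivative has a pole of order k + 1, whereas the kernel is holomorphic. So
  \<open>(s - p) / (\<psi> s - \<psi> p)\<close> is entire; it grows at most linearly and is the
  denominator of \<open>\<psi>\<close>. Stationarity comes from an inequality: replacing one
  fraction of the reduced transform changes the squared error by a term linear in the displacement,
  up to second order. The displacement is a free small complex number, so the linear coefficient
  must vanish.\<close>

lemma conformal_settingD:
  assumes "conformal_setting \<psi> X A"
  shows "\<psi> nicely_meromorphic_on UNIV" "open X" "\<And>z. z \<in> X \<Longrightarrow> Re z < 0"
    "\<And>z. z \<in> X \<Longrightarrow> \<psi> analytic_on {z}" "\<And>z. z \<in> X \<Longrightarrow> deriv \<psi> z \<noteq> 0"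
    "inj_on \<psi> X" "\<psi> ` X = A"
    "\<And>z. z \<in> X \<Longrightarrow> \<psi> analytic_on {- cnj z}" "\<And>z. z \<in> X \<Longrightarrow> deriv \<psi> (- cnj z) \<noteq> 0"
    "\<And>z. z \<in> X \<Longrightarrow> \<psi> (- cnj z) \<in> - closure A"
proof -
  obtain Xt where Xt: "open Xt" "{s. - cnj s \<in> X} \<subseteq> Xt" "conformal_on \<psi> Xt" "\<psi> ` Xt \<subseteq> - closure A"
    using assms unfolding conformal_setting_def by blast
  have "- cnj z \<in> Xt" if "z \<in> X" for z
    using Xt(2) that by (auto intro!: subsetD[OF Xt(2)])
  with Xt show "\<And>z. z \<in> X \<Longrightarrow> \<psi> analytic_on {- cnj z}" "\<And>z. z \<in> X \<Longrightarrow> deriv \<psi> (- cnj z) \<noteq> 0"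
    "\<And>z. z \<in> X \<Longrightarrow> \<psi> (- cnj z) \<in> - closure A"
    unfolding conformal_on_def using analytic_on_analytic_at by blast+
qed (use assms in \<open>auto simp: conformal_setting_def conformal_on_def bij_betw_def
       analytic_on_analytic_at[of \<psi> X]\<close>)

lemma psi_inv_facts:
  assumes "conformal_setting \<psi> X A" "\<mu> \<in> A"
  shows "psi_inv \<psi> X \<mu> \<in> X" "\<psi> (psi_inv \<psi> X \<mu>) = \<mu>"
  using conformal_settingD(7)[OF assms(1)] assms(2) by (auto intro: inv_into_into f_inv_into_f)

text \<open>\<open>inv_into\<close> is a choice operator; it inherits its derivative from the
  holomorphic inverse, with which it agrees on the open set \<open>A\<close>.\<close>

lemma psi_inv_has_field_derivative:
  assumes "conformal_setting \<psi> X A" "\<mu> \<in> A"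
  shows "(psi_inv \<psi> X has_field_derivative inverse (deriv \<psi> (psi_inv \<psi> X \<mu>))) (at \<mu>)"
proof -
  note C = conformal_settingD[OF assms(1)]
  have hol: "\<psi> holomorphic_on X"
    using C(4) analytic_imp_holomorphic analytic_on_analytic_at by blast
  obtain g where g: "g holomorphic_on A" "\<And>z. z \<in> X \<Longrightarrow> deriv \<psi> z * deriv g (\<psi> z) = 1"
    "\<And>z. z \<in> X \<Longrightarrow> g (\<psi> z) = z"
    using holomorphic_has_inverse[OF hol C(2) C(6)] unfolding C(7) by blast
  have "open A"
    using open_mapping_thm3[OF hol C(2) C(6)] C(7) by simp
  have eq: "g s = psi_inv \<psi> X s" if "s \<in> A" for s
    using g(3)[OF psi_inv_facts(1)[OF assms(1) that]] psi_inv_facts(2)[OF assms(1) that] by simp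
  have "(g has_field_derivative deriv g \<mu>) (at \<mu>)"
    using g(1) \<open>open A\<close> assms(2) by (rule holomorphic_derivI)
  moreover have "deriv g \<mu> = inverse (deriv \<psi> (psi_inv \<psi> X \<mu>))"
    using g(2)[OF psi_inv_facts(1)[OF assms]] psi_inv_facts(2)[OF assms]
    using conformal_settingD(5)[OF assms(1) psi_inv_facts(1)[OF assms]] by (simp add: field_simps)
  ultimately show ?thesis
    by (auto intro: has_field_derivative_transform_within_open[OF _ \<open>open A\<close> assms(2) eq])
qed

text \<open>Dividing the relation of the squares by \<open>(s - w)^2\<close> and letting s tend to w
  gives \<open>h'^2 = e'^2 * d0\<close>. Only squares are related, because the factor between
  \<open>h\<close> and \<open>e\<close> will be a root whose sign may jump near w.\<close>

lemma deriv_eq_zero_iff_if_square_eq: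
  fixes h e d :: "complex \<Rightarrow> complex"
  assumes "(h has_field_derivative h') (at w)" "(e has_field_derivative e') (at w)"
    "h w = 0" "e w = 0" "d \<midarrow>w\<rightarrow> d0" "d0 \<noteq> 0"
    and ev: "eventually (\<lambda>s. h s ^ 2 = e s ^ 2 * d s) (at w)"
  shows "h' = 0 \<longleftrightarrow> e' = 0"
proof -
  have h: "((\<lambda>s. (h s / (s - w)) ^ 2) \<longlongrightarrow> h' ^ 2) (at w)"
    and e: "((\<lambda>s. (e s / (s - w)) ^ 2 * d s) \<longlongrightarrow> e' ^ 2 * d0) (at w)"
    using assms(1-5) by (auto simp: has_field_derivative_iff intro!: tendsto_intros)
  have "eventually (\<lambda>s. (h s / (s - w)) ^ 2 = (e s / (s - w)) ^ 2 * d s) (at w)"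
    using ev by eventually_elim (simp add: power_divide)
  from tendsto_cong[OF this] h e have "h' ^ 2 = e' ^ 2 * d0"
    using tendsto_unique[OF trivial_limit_at] by blast
  then show ?thesis using assms(6) by auto
qed

lemma eventually_hfrak_eq:
  assumes "\<psi> analytic_on {w}"
  shows "eventually (\<lambda>s. \<not> is_pole \<psi> s \<and> hfrak \<psi> q F s = F (\<psi> s) * q s) (nhds w)"
proof -
  obtain S where "open S" "w \<in> S" "\<psi> analytic_on S"
    using assms by (metis analytic_at analytic_on_open)
  then have "\<not> is_pole \<psi> s" if "s \<in> S" for s
    using that analytic_at_imp_no_pole analytic_on_analytic_at by metis
  then show ?thesis
    using \<open>open S\<close> \<open>w \<in> S\<close> by (auto simp: eventually_nhds hfrak_def)
qed

lemma hermite_hfrak_iff: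
  assumes root: "sqrt_deriv \<psi> q" and psi: "\<psi> analytic_on {w}" "deriv \<psi> w \<noteq> 0"
    and h: "hfrak \<psi> q F field_differentiable at w" "hfrak \<psi> q G field_differentiable at w"
    and fg: "F field_differentiable at (\<psi> w)" "G field_differentiable at (\<psi> w)"
  shows "hfrak \<psi> q F w = hfrak \<psi> q G w \<and> deriv (hfrak \<psi> q F) w = deriv (hfrak \<psi> q G) w
    \<longleftrightarrow> F (\<psi> w) = G (\<psi> w) \<and> deriv F (\<psi> w) = deriv G (\<psi> w)"
proof -
  define h where "h s = hfrak \<psi> q F s - hfrak \<psi> q G s" for s
  define e where "e s = F (\<psi> s) - G (\<psi> s)" for s
  have ev: "eventually (\<lambda>s. \<not> is_pole \<psi> s \<and> h s = e s * q s) (nhds w)"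
    using eventually_hfrak_eq[OF psi(1), of q F] eventually_hfrak_eq[OF psi(1), of q G]
    by eventually_elim (simp add: h_def e_def algebra_simps)
  have np: "\<not> is_pole \<psi> w" and hw: "h w = e w * q w"
    using eventually_nhds_x_imp_x[OF ev] by auto
  have qw: "q w ^ 2 = deriv \<psi> w"
    using root np by (simp add: sqrt_deriv_def)
  have hw0: "h w = 0 \<longleftrightarrow> e w = 0"
    using hw qw psi(2) by auto
  have dh: "(h has_field_derivative deriv (hfrak \<psi> q F) w - deriv (hfrak \<psi> q G) w) (at w)"
    unfolding h_def using h by (intro DERIV_diff) (simp_all add: field_differentiable_derivI)
  have dpsi: "(\<psi> has_field_derivative deriv \<psi> w) (at w)"
    using psi(1) analytic_on_imp_differentiable_at field_differentiable_derivI by blast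
  have de: "(e has_field_derivative (deriv F (\<psi> w) - deriv G (\<psi> w)) * deriv \<psi> w) (at w)"
    unfolding e_def left_diff_distrib using fg
    by (intro DERIV_diff DERIV_chain2[OF _ dpsi]) (simp_all add: field_differentiable_derivI)
  \<comment> \<open>Squaring \<open>h = e * q\<close> leaves only the derivative of
    \<open>\<psi>\<close>, which is continuous at w even if \<open>q\<close> is not.\<close>
  have "eventually (\<lambda>s. h s ^ 2 = e s ^ 2 * deriv \<psi> s) (at w)"
    using eventually_nhds_conv_at[THEN iffD1, OF ev, THEN conjunct1]
    by eventually_elim (use root in \<open>auto simp: sqrt_deriv_def power_mult_distrib\<close>)
  moreover have "deriv \<psi> \<midarrow>w\<rightarrow> deriv \<psi> w"
    using analytic_deriv[OF psi(1)] analytic_at_imp_isCont isContD by blast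
  \<comment> \<open>The derivatives are compared only when the values agree; otherwise both sides of
    the claim fail already in their first conjunct.\<close>
  ultimately have "h w = 0 \<Longrightarrow>
     deriv (hfrak \<psi> q F) w - deriv (hfrak \<psi> q G) w = 0 \<longleftrightarrow> (deriv F (\<psi> w) - deriv G (\<psi> w)) * deriv \<psi> w = 0"
    using deriv_eq_zero_iff_if_square_eq[OF dh de _ _ _ psi(2)] hw0 by blast
  then show ?thesis
    using hw0 psi(2) by (auto simp: h_def e_def)
qed

lemma frakF_same_poles:
  assumes "{z. is_pole \<psi> z} = {z. is_pole q z}"
  shows "frakF \<psi> q X \<Gamma> F s =
    cnj (hfrak \<psi> q F (- cnj (psi_inv \<psi> X s))) * inverse (q (psi_inv \<psi> X s))"
  using assms by (simp add: frakF_def cbar_def)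

text \<open>The map s \<mapsto> \<open>cnj (f (cnj s))\<close> preserves holomorphy, so
  \<open>frakF\<close> is a product of holomorphic factors near \<mu>, the second of them nonzero
  there.\<close>

lemma hermite_frakF_iff:
  assumes setting: "conformal_setting \<psi> X A" and root: "sqrt_deriv \<psi> q" "q analytic_on X"
    and same: "{z. is_pole \<psi> z} = {z. is_pole q z}" and lam: "\<mu> \<in> A"
    and w: "w = - cnj (psi_inv \<psi> X \<mu>)"
    and h: "hfrak \<psi> q F field_differentiable at w" "hfrak \<psi> q G field_differentiable at w"
  shows "frakF \<psi> q X \<Gamma> F \<mu> = frakF \<psi> q X \<Gamma> G \<mu> \<and>
      deriv (frakF \<psi> q X \<Gamma> F) \<mu> = deriv (frakF \<psi> q X \<Gamma> G) \<mu>
    \<longleftrightarrow> hfrak \<psi> q F w = hfrak \<psi> q G w \<and> deriv (hfrak \<psi> q F) w = deriv (hfrak \<psi> q G) w"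
proof -
  note C = conformal_settingD[OF setting]
  define z where "z = psi_inv \<psi> X \<mu>"
  have z: "z \<in> X" using psi_inv_facts(1)[OF setting lam] by (simp add: z_def)
  have "\<not> is_pole \<psi> z" using C(4)[OF z] analytic_at_imp_no_pole by blast
  then have "q z ^ 2 = deriv \<psi> z" using root(1) by (simp add: sqrt_deriv_def)
  then have qz: "q z \<noteq> 0" using C(5)[OF z] by auto
  have dq: "(q has_field_derivative deriv q z) (at z)"
    using root(2) z analytic_on_imp_differentiable_at field_differentiable_derivI by blast
  have dz: "(psi_inv \<psi> X has_field_derivative inverse (deriv \<psi> z)) (at \<mu>)"
    using psi_inv_has_field_derivative[OF setting lam] by (simp add: z_def)
  \<comment> \<open>Chain rule for \<open>1 / q\<close> after the inverse map. In the product rule B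
    multiplies the value of the transform at w, so its contributions cancel once the values
    agree.\<close>
  define B where "B = - (inverse (q z ^ 2) * (deriv q z * inverse (deriv \<psi> z)))"
  have dinv: "((\<lambda>s. inverse (q (psi_inv \<psi> X s))) has_field_derivative B) (at \<mu>)"
    using DERIV_inverse_fun[OF DERIV_chain2[OF dq[unfolded z_def] dz[unfolded z_def]]] qz
    by (simp add: B_def z_def power2_eq_square mult_ac)
  have der: "(frakF \<psi> q X \<Gamma> K has_field_derivative
      - (cnj (deriv (hfrak \<psi> q K) w) * inverse (deriv \<psi> z)) * inverse (q z) + cnj (hfrak \<psi> q K w) * B) (at \<mu>)"
    if K: "hfrak \<psi> q K field_differentiable at w" for K
  proof -
    have "((cnj \<circ> hfrak \<psi> q K \<circ> cnj) has_field_derivative cnj (deriv (hfrak \<psi> q K) w)) (at (- z))"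
      by (rule has_field_derivative_cnj_cnj) (use K in \<open>simp add: w z_def field_differentiable_derivI\<close>)
    then have "((cnj \<circ> hfrak \<psi> q K \<circ> cnj) has_field_derivative cnj (deriv (hfrak \<psi> q K) w)) (at (- psi_inv \<psi> X \<mu>))"
      by (simp add: z_def)
    from DERIV_chain2[OF this DERIV_minus[OF dz]]
    have "((\<lambda>s. cnj (hfrak \<psi> q K (- cnj (psi_inv \<psi> X s)))) has_field_derivative
        - (cnj (deriv (hfrak \<psi> q K) w) * inverse (deriv \<psi> z))) (at \<mu>)"
      by simp
    from DERIV_mult[OF this dinv] show ?thesis
      unfolding frakF_same_poles[OF same, abs_def] by (simp add: w z_def mult_ac)
  qed
  have val: "frakF \<psi> q X \<Gamma> K \<mu> = cnj (hfrak \<psi> q K w) * inverse (q z)" for K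
    using frakF_same_poles[OF same, of X \<Gamma> K \<mu>] by (simp add: w z_def)
  show ?thesis
    unfolding val DERIV_imp_deriv[OF der[OF h(1)]] DERIV_imp_deriv[OF der[OF h(2)]]
    using qz C(5)[OF z] by auto
qed

lemma H2_ext_field_differentiable:
  assumes "F \<in> H2_ext \<psi> q A"
  shows "Re s > 0 \<Longrightarrow> hfrak \<psi> q F field_differentiable at s"
    and "s \<in> - closure A \<Longrightarrow> F field_differentiable at s"
proof -
  have "open {s::complex. Re s > 0}" by (simp add: open_halfspace_Re_gt)
  then show "Re s > 0 \<Longrightarrow> hfrak \<psi> q F field_differentiable at s"
    using assms by (auto simp: H2_ext_def H2_rhp_def intro: holomorphic_on_imp_differentiable_at)
  show "s \<in> - closure A \<Longrightarrow> F field_differentiable at s"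
    using assms holomorphic_on_imp_differentiable_at[of F "- closure A" s]
    by (auto simp: H2_ext_def)
qed

section \<open>Hardy space functions that are regular on the closed half plane\<close>

text \<open>The weight \<open>1 + cmod s\<close> expresses boundedness near 0 and decay like 1/s at
  infinity in one estimate. This makes boundary integrals of products converge absolutely and lets
  large half circles be discarded.\<close>

definition rhp_regular :: "(complex \<Rightarrow> complex) \<Rightarrow> bool" where
  "rhp_regular R \<longleftrightarrow> R analytic_on {s. 0 \<le> Re s} \<and>
     (\<exists>C. \<forall>s. 0 \<le> Re s \<longrightarrow> cmod (R s) * (1 + cmod s) \<le> C)"

lemma rhp_regular_add:
  assumes "rhp_regular R" "rhp_regular S"
  shows "rhp_regular (\<lambda>s. R s + S s)"
proof -
  obtain C D where C: "\<And>s. 0 \<le> Re s \<Longrightarrow> cmod (R s) * (1 + cmod s) \<le> C"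
    and D: "\<And>s. 0 \<le> Re s \<Longrightarrow> cmod (S s) * (1 + cmod s) \<le> D"
    using assms unfolding rhp_regular_def by blast
  have "cmod (R s + S s) * (1 + cmod s) \<le> C + D" if "0 \<le> Re s" for s
  proof -
    have "cmod (R s + S s) * (1 + cmod s) \<le> (cmod (R s) + cmod (S s)) * (1 + cmod s)"
      by (intro mult_right_mono norm_triangle_ineq) auto
    with C[OF that] D[OF that] show ?thesis by (simp add: algebra_simps)
  qed
  moreover have "(\<lambda>s. R s + S s) analytic_on {s. 0 \<le> Re s}"
    using assms by (intro analytic_intros) (auto simp: rhp_regular_def)
  ultimately show ?thesis unfolding rhp_regular_def by blast
qed

lemma rhp_regular_cmult:
  assumes "rhp_regular R"
  shows "rhp_regular (\<lambda>s. c * R s)"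
proof -
  obtain C where C: "\<And>s. 0 \<le> Re s \<Longrightarrow> cmod (R s) * (1 + cmod s) \<le> C"
    using assms unfolding rhp_regular_def by blast
  have "cmod (c * R s) * (1 + cmod s) \<le> cmod c * C" if "0 \<le> Re s" for s
    using mult_left_mono[OF C[OF that], of "cmod c"] by (simp add: norm_mult mult_ac)
  moreover have "(\<lambda>s. c * R s) analytic_on {s. 0 \<le> Re s}"
    using assms by (intro analytic_intros) (auto simp: rhp_regular_def)
  ultimately show ?thesis unfolding rhp_regular_def by blast
qed

lemma rhp_regular_diff:
  assumes "rhp_regular R" "rhp_regular S"
  shows "rhp_regular (\<lambda>s. R s - S s)"
  using rhp_regular_add[OF assms(1) rhp_regular_cmult[OF assms(2), of "-1"]] by simp

lemma rhp_regular_sum: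
  assumes "\<And>i. i \<in> I \<Longrightarrow> rhp_regular (R i)"
  shows "rhp_regular (\<lambda>s. \<Sum>i\<in>I. R i s)"
  using assms
proof (induction I rule: infinite_finite_induct)
  case (insert i I)
  then show ?case by (simp add: rhp_regular_add)
qed (auto simp: rhp_regular_def)

lemma rhp_regular_pole:
  assumes "Re p < 0"
  shows "rhp_regular (\<lambda>s. 1 / (s - p))"
proof -
  have "cmod (1 / (s - p)) * (1 + cmod s) \<le> 1 + (1 + cmod p) / (- Re p)" if "0 \<le> Re s" for s
  proof -
    \<comment> \<open>On the closed half plane the distance to p is at least \<open>- Re p\<close>,
      so \<open>1 + cmod p\<close> is at most k times that distance, and \<open>1 + cmod s\<close>
      at most \<open>1 + k\<close> times it.\<close>
    define k where "k = (1 + cmod p) / (- Re p)"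
    have k: "k \<ge> 0" "1 + cmod p = k * (- Re p)"
      using assms by (simp_all add: k_def divide_nonneg_neg)
    have a: "- Re p \<le> cmod (s - p)"
      using that abs_Re_le_cmod[of "s - p"] by simp
    with assms have pos: "cmod (s - p) > 0" by linarith
    have "1 + cmod s \<le> cmod (s - p) + (1 + cmod p)"
      using norm_triangle_ineq2[of s p] by simp
    also have "1 + cmod p \<le> k * cmod (s - p)"
      unfolding k(2) by (rule mult_left_mono[OF a k(1)])
    finally show ?thesis
      unfolding k_def[symmetric] using pos by (simp add: norm_divide pos_divide_le_eq algebra_simps)
  qed
  moreover have "(\<lambda>s. 1 / (s - p)) analytic_on {s. 0 \<le> Re s}"
    using assms by (intro analytic_intros) auto
  ultimately show ?thesis unfolding rhp_regular_def by blast
qed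

section \<open>Proper quotients of polynomials\<close>

lemma poly_analytic: "poly P analytic_on UNIV" for P :: "complex poly"
  by (simp add: analytic_on_open poly_holomorphic_on)

text \<open>For nonzero P the quotient of \<open>poly P s\<close> by \<open>s ^ degree P\<close>
  tends to the leading coefficient, so its modulus ends up between half of the limit and the limit
  plus 1.\<close>

lemma poly_norm_bounds_at_infinity:
  fixes P :: "complex poly"
  shows "eventually (\<lambda>s. cmod (poly P s) \<le> (cmod (lead_coeff P) + 1) * cmod s ^ degree P \<and>
      cmod (lead_coeff P) / 2 * cmod s ^ degree P \<le> cmod (poly P s)) at_infinity"
proof (cases "P = 0")
  case False
  have "eventually (\<lambda>s. cmod (poly P s / s ^ degree P) < cmod (lead_coeff P) + 1) at_infinity"
    by (rule order_tendstoD(2)[OF tendsto_norm[OF poly_divide_tendsto_aux]]) simp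
  moreover have "eventually (\<lambda>s. cmod (lead_coeff P) / 2 < cmod (poly P s / s ^ degree P)) at_infinity"
    by (rule order_tendstoD(1)[OF tendsto_norm[OF poly_divide_tendsto_aux]]) (use False in simp)
  moreover have "eventually (\<lambda>s::complex. 1 \<le> cmod s) at_infinity"
    by (auto simp: eventually_at_infinity)
  ultimately show ?thesis
  proof eventually_elim
    case (elim s)
    then have pos: "cmod s ^ degree P > 0" by (auto intro!: zero_less_power)
    have "cmod (poly P s) / cmod s ^ degree P < cmod (lead_coeff P) + 1"
      "cmod (lead_coeff P) / 2 < cmod (poly P s) / cmod s ^ degree P"
      using elim by (simp_all add: norm_divide norm_power)
    then show ?case
      unfolding pos_divide_less_eq[OF pos] pos_less_divide_eq[OF pos] by (auto intro: less_imp_le)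
  qed
qed simp

lemma rhp_regular_poly_divide:
  assumes deg: "degree P < degree Q" and nz: "\<And>s. 0 \<le> Re s \<Longrightarrow> poly Q s \<noteq> 0"
  shows "rhp_regular (\<lambda>s. poly P s / poly Q s)"
proof -
  obtain B \<rho> where B: "\<And>s. cmod s \<ge> \<rho> \<Longrightarrow> cmod (poly P s) * (1 + cmod s) \<le> B * cmod (poly Q s)"
  proof -
    have "eventually (\<lambda>s::complex. 1 \<le> cmod s) at_infinity"
      by (auto simp: eventually_at_infinity)
    with poly_norm_bounds_at_infinity[of P] poly_norm_bounds_at_infinity[of Q]
    \<comment> \<open>The 4 collects a 2 from \<open>1 + cmod s \<le> 2 * cmod s\<close> and a 2
      from the lower bound by half the leading coefficient of Q.\<close>
    have "eventually (\<lambda>s. cmod (poly P s) * (1 + cmod s)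
        \<le> (cmod (lead_coeff P) + 1) * 4 / cmod (lead_coeff Q) * cmod (poly Q s)) at_infinity"
    proof eventually_elim
      case (elim s)
      have Q0: "lead_coeff Q \<noteq> 0" using deg by auto
      have Q: "cmod s ^ degree Q \<le> 2 / cmod (lead_coeff Q) * cmod (poly Q s)"
        using elim Q0 by (simp add: field_simps)
      have "cmod (poly P s) * (1 + cmod s) \<le> (cmod (lead_coeff P) + 1) * cmod s ^ degree P * (2 * cmod s)"
        using elim by (intro mult_mono) auto
      also have "\<dots> = (cmod (lead_coeff P) + 1) * 2 * cmod s ^ Suc (degree P)"
        by simp
      also have "\<dots> \<le> (cmod (lead_coeff P) + 1) * 2 * cmod s ^ degree Q"
        using deg elim by (intro mult_left_mono power_increasing) auto
      also have "\<dots> \<le> (cmod (lead_coeff P) + 1) * 2 * (2 / cmod (lead_coeff Q) * cmod (poly Q s))"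
        by (intro mult_left_mono Q) auto
      finally show ?case by (simp add: field_simps)
    qed
    then show ?thesis using that unfolding eventually_at_infinity by blast
  qed
  \<comment> \<open>The remaining half disc is compact and free of zeros of Q, so continuity bounds
    the quotient there.\<close>
  have K: "compact (cball 0 \<rho> \<inter> {s. 0 \<le> Re s})"
    by (intro compact_Int_closed compact_cball closed_halfspace_Re_ge)
  have "continuous_on (cball 0 \<rho> \<inter> {s. 0 \<le> Re s}) (\<lambda>s. cmod (poly P s / poly Q s) * (1 + cmod s))"
    using nz by (intro continuous_intros) auto
  from compact_imp_bounded[OF compact_continuous_image[OF this K]] obtain D
    where "\<forall>y\<in>(\<lambda>s. cmod (poly P s / poly Q s) * (1 + cmod s)) ` (cball 0 \<rho> \<inter> {s. 0 \<le> Re s}). \<bar>y\<bar> \<le> D"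
    unfolding bounded_real by blast
  then have D: "cmod (poly P s / poly Q s) * (1 + cmod s) \<le> D" if "cmod s \<le> \<rho>" "0 \<le> Re s" for s
    using that by (auto dest!: bspec abs_le_D1)
  have "cmod (poly P s / poly Q s) * (1 + cmod s) \<le> max B D" if s: "0 \<le> Re s" for s
  proof (cases "cmod s \<le> \<rho>")
    case True
    then show ?thesis using D[OF True s] by simp
  next
    case False
    then have "cmod (poly P s) * (1 + cmod s) \<le> B * cmod (poly Q s)" by (intro B) simp
    then have "cmod (poly P s / poly Q s) * (1 + cmod s) \<le> B"
      using nz[OF s] by (simp add: norm_divide field_simps)
    then show ?thesis by simp
  qed
  moreover have "(\<lambda>s. poly P s / poly Q s) analytic_on {s. 0 \<le> Re s}"
    using nz by (intro analytic_on_divide) (auto intro!: analytic_on_subset[OF poly_analytic])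
  ultimately show ?thesis unfolding rhp_regular_def by blast
qed

section \<open>Integrals along vertical lines and the Hardy norm\<close>

lemma integrable_inverse_1_plus_square_lborel:
  "integrable lborel (\<lambda>x::real. inverse (1 + x^2))" "(LINT x|lborel. inverse (1 + x^2)) = pi"
  using integrable_inverse_1_plus_square LBINT_inverse_1_plus_square
  by (simp_all add: set_integrable_def interval_lebesgue_integral_def set_lebesgue_integral_def einterval_def)

text \<open>The majorant does not depend on x, which gives the supremum over vertical lines as well
  as integrability on the axis.\<close>

lemma rhp_regular_bound:
  assumes "rhp_regular R"
  obtains C where "\<And>x \<omega>. 0 \<le> x \<Longrightarrow> cmod (R (Complex x \<omega>)) ^ 2 \<le> C * inverse (1 + \<omega> ^ 2)"
proof -
  obtain C where C: "\<And>s. 0 \<le> Re s \<Longrightarrow> cmod (R s) * (1 + cmod s) \<le> C"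
    using assms unfolding rhp_regular_def by blast
  show ?thesis
  proof
    fix x \<omega> :: real assume x: "0 \<le> x"
    let ?s = "Complex x \<omega>"
    have "\<omega> ^ 2 \<le> cmod ?s ^ 2" by (simp add: cmod_def)
    then have "1 + \<omega> ^ 2 \<le> (1 + cmod ?s) ^ 2"
      by (simp add: power2_sum add_increasing2)
    then have "cmod (R ?s) ^ 2 * (1 + \<omega> ^ 2) \<le> (cmod (R ?s) * (1 + cmod ?s)) ^ 2"
      by (simp add: power_mult_distrib mult_left_mono)
    also have "\<dots> \<le> C ^ 2"
      using C[of ?s] x by (intro power_mono) auto
    finally show "cmod (R ?s) ^ 2 \<le> C ^ 2 * inverse (1 + \<omega> ^ 2)"
      by (simp add: field_simps add_pos_nonneg)
  qed
qed

lemma continuous_on_Complex_axis [continuous_intros]: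
  "continuous_on S (\<lambda>\<omega>. Complex x \<omega>)"
proof -
  have "(\<lambda>\<omega>. Complex x \<omega>) = (\<lambda>\<omega>. of_real x + \<i> * of_real \<omega>)"
    by (simp add: fun_eq_iff complex_eq_iff)
  then show ?thesis by (simp add: continuous_intros)
qed

lemma rhp_regular_continuous_on_axis:
  assumes "rhp_regular R"
  shows "continuous_on UNIV (\<lambda>\<omega>. R (Complex 0 \<omega>))"
proof -
  have "continuous_on {s. 0 \<le> Re s} R"
    using assms analytic_imp_holomorphic holomorphic_on_imp_continuous_on by (auto simp: rhp_regular_def)
  then show ?thesis
    by (rule continuous_on_compose2) (auto intro: continuous_intros)
qed

lemma rhp_regular_in_H2_rhp:
  assumes R: "rhp_regular R" and h: "\<And>s. Re s > 0 \<Longrightarrow> h s = R s"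
  shows "h \<in> H2_rhp"
proof -
  obtain C where C: "\<And>x \<omega>. 0 \<le> x \<Longrightarrow> cmod (R (Complex x \<omega>)) ^ 2 \<le> C * inverse (1 + \<omega> ^ 2)"
    using rhp_regular_bound[OF R] by blast
  have "R analytic_on {s. 0 < Re s}"
    using R unfolding rhp_regular_def by (auto elim: analytic_on_subset)
  then have "h holomorphic_on {s. 0 < Re s}"
    using h by (subst holomorphic_cong[of _ _ h R]) (auto dest: analytic_imp_holomorphic)
  moreover have "(\<integral>\<^sup>+ \<omega>. ennreal (cmod (h (Complex x \<omega>)) ^ 2) \<partial>lborel)
      \<le> (\<integral>\<^sup>+ \<omega>. ennreal (C * inverse (1 + \<omega> ^ 2)) \<partial>lborel)" if "x > 0" for x
    using C[of x] that h by (intro nn_integral_mono ennreal_leI) simp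
  moreover have "(\<integral>\<^sup>+ \<omega>. ennreal (C * inverse (1 + \<omega> ^ 2)) \<partial>lborel) < \<infinity>"
  proof -
    have "0 \<le> C" using C[of 0 0] by (simp add: order_trans[OF zero_le_power2])
    then show ?thesis
      using integrable_inverse_1_plus_square_lborel(1)
      by (subst nn_integral_eq_integral) (auto intro!: integrable_mult_right simp: ennreal_less_top)
  qed
  ultimately show ?thesis
    unfolding H2_rhp_def by (auto intro!: le_less_trans[OF SUP_least])
qed

text \<open>This is the Hardy inner product without the factor \<open>1 / (2 * pi)\<close>, which
  reappears in \<open>H2_rhp_norm_eq\<close>.\<close>

definition axis_inner :: "(complex \<Rightarrow> complex) \<Rightarrow> (complex \<Rightarrow> complex) \<Rightarrow> complex" where
  "axis_inner R S = (LINT \<omega>|lborel. cnj (R (Complex 0 \<omega>)) * S (Complex 0 \<omega>))"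

definition axis_energy :: "(complex \<Rightarrow> complex) \<Rightarrow> real" where
  "axis_energy R = (LINT \<omega>|lborel. cmod (R (Complex 0 \<omega>)) ^ 2)"

lemma integrable_axis_inner:
  assumes R: "rhp_regular R" and S: "rhp_regular S"
  shows "integrable lborel (\<lambda>\<omega>. cnj (R (Complex 0 \<omega>)) * S (Complex 0 \<omega>))"
proof -
  obtain C where C: "\<And>x \<omega>. 0 \<le> x \<Longrightarrow> cmod (R (Complex x \<omega>)) ^ 2 \<le> C * inverse (1 + \<omega> ^ 2)"
    using rhp_regular_bound[OF R] by blast
  obtain D where D: "\<And>x \<omega>. 0 \<le> x \<Longrightarrow> cmod (S (Complex x \<omega>)) ^ 2 \<le> D * inverse (1 + \<omega> ^ 2)"
    using rhp_regular_bound[OF S] by blast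
  show ?thesis
  proof (rule Bochner_Integration.integrable_bound)
    show "integrable lborel (\<lambda>\<omega>::real. (C + D) * inverse (1 + \<omega> ^ 2))"
      using integrable_inverse_1_plus_square_lborel(1) by (rule integrable_mult_right)
    show "AE \<omega> in lborel. norm (cnj (R (Complex 0 \<omega>)) * S (Complex 0 \<omega>)) \<le> norm ((C + D) * inverse (1 + \<omega> ^ 2))"
    proof (rule AE_I2)
      fix \<omega> :: real
      let ?r = "cmod (R (Complex 0 \<omega>))" and ?s = "cmod (S (Complex 0 \<omega>))"
      have "?r * ?s \<le> ?r ^ 2 + ?s ^ 2"
        using sum_squares_bound[of ?r ?s] mult_nonneg_nonneg[OF norm_ge_zero norm_ge_zero, of "R (Complex 0 \<omega>)" "S (Complex 0 \<omega>)"]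
        by linarith
      also have "\<dots> \<le> (C + D) * inverse (1 + \<omega> ^ 2)"
        using C[of 0 \<omega>] D[of 0 \<omega>] by (simp add: algebra_simps)
      finally show "norm (cnj (R (Complex 0 \<omega>)) * S (Complex 0 \<omega>)) \<le> norm ((C + D) * inverse (1 + \<omega> ^ 2))"
        by (simp add: norm_mult)
    qed
    have "continuous_on UNIV (\<lambda>\<omega>. cnj (R (Complex 0 \<omega>)) * S (Complex 0 \<omega>))"
      using R S by (intro continuous_intros rhp_regular_continuous_on_axis)
    then show "(\<lambda>\<omega>. cnj (R (Complex 0 \<omega>)) * S (Complex 0 \<omega>)) \<in> borel_measurable lborel"
      by (simp add: borel_measurable_continuous_onI)
  qed
qed

lemma integrable_axis_energy:
  assumes R: "rhp_regular R"
  shows "integrable lborel (\<lambda>\<omega>. cmod (R (Complex 0 \<omega>)) ^ 2)"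
proof -
  have "integrable lborel (\<lambda>\<omega>. Re (cnj (R (Complex 0 \<omega>)) * R (Complex 0 \<omega>)))"
    by (rule integrable_Re[OF integrable_axis_inner[OF R R]])
  then show ?thesis unfolding cmod_power2 by (simp add: power2_eq_square)
qed

lemma axis_energy_diff:
  assumes R: "rhp_regular R" and S: "rhp_regular S"
  shows "axis_energy (\<lambda>s. R s - S s) = axis_energy R - 2 * Re (axis_inner R S) + axis_energy S"
proof -
  note I = integrable_axis_energy[OF R] integrable_axis_energy[OF S] integrable_Re[OF integrable_axis_inner[OF R S]]
  have "cmod (u - v) ^ 2 = cmod u ^ 2 - 2 * Re (cnj u * v) + cmod v ^ 2" for u v
    unfolding cmod_power2 by (simp add: power2_eq_square algebra_simps)
  then have "axis_energy (\<lambda>s. R s - S s) = (LINT \<omega>|lborel. cmod (R (Complex 0 \<omega>)) ^ 2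
      - 2 * Re (cnj (R (Complex 0 \<omega>)) * S (Complex 0 \<omega>)) + cmod (S (Complex 0 \<omega>)) ^ 2)"
    by (simp add: axis_energy_def)
  also have "\<dots> = axis_energy R - 2 * (LINT \<omega>|lborel. Re (cnj (R (Complex 0 \<omega>)) * S (Complex 0 \<omega>))) + axis_energy S"
    unfolding axis_energy_def using I
    by (simp only: Bochner_Integration.integral_add Bochner_Integration.integral_diff
        Bochner_Integration.integrable_diff integrable_mult_right integral_mult_right_zero)
  also have "(LINT \<omega>|lborel. Re (cnj (R (Complex 0 \<omega>)) * S (Complex 0 \<omega>))) = Re (axis_inner R S)"
    unfolding axis_inner_def by (rule integral_Re[OF integrable_axis_inner[OF R S]])
  finally show ?thesis .
qed

lemma axis_energy_mono:
  assumes R: "rhp_regular R" and S: "rhp_regular S"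
    and le: "\<And>s. Re s = 0 \<Longrightarrow> cmod (R s) \<le> K * cmod (S s)"
  shows "axis_energy R \<le> K ^ 2 * axis_energy S"
proof -
  have "axis_energy R \<le> (LINT \<omega>|lborel. K ^ 2 * cmod (S (Complex 0 \<omega>)) ^ 2)"
    unfolding axis_energy_def
  proof (rule integral_mono)
    fix \<omega> :: real
    have "cmod (R (Complex 0 \<omega>)) ^ 2 \<le> (K * cmod (S (Complex 0 \<omega>))) ^ 2"
      using le by (intro power_mono) auto
    then show "cmod (R (Complex 0 \<omega>)) ^ 2 \<le> K ^ 2 * cmod (S (Complex 0 \<omega>)) ^ 2"
      by (simp add: power_mult_distrib)
  qed (use integrable_axis_energy[OF R] integrable_axis_energy[OF S] in auto)
  then show ?thesis by (simp add: axis_energy_def)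
qed

text \<open>The exceptional set K is for poles of \<open>\<psi>\<close>, where \<open>hfrak\<close>
  of a difference is a limit taken afresh. A horizontal approach to the axis avoids finitely many
  points from some moment on, so the boundary values see only R.\<close>

lemma H2_rhp_norm_eq:
  assumes R: "rhp_regular R" and K: "finite K" and h: "\<And>s. Re s > 0 \<Longrightarrow> s \<notin> K \<Longrightarrow> h s = R s"
  shows "H2_rhp_norm h = sqrt (axis_energy R / (2 * pi))"
proof -
  have bv: "bvalue h \<omega> = R (Complex 0 \<omega>)" for \<omega>
  proof -
    have "eventually (\<lambda>x. \<forall>k\<in>K. x \<noteq> Re k) (at_right (0::real))"
      by (rule eventually_ball_finite[OF K]) (simp add: eventually_neq_at_within)
    moreover have "eventually (\<lambda>x. x > 0) (at_right (0::real))"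
      by (rule eventually_at_right_less)
    ultimately have ev: "eventually (\<lambda>x. R (Complex x \<omega>) = h (Complex x \<omega>)) (at_right 0)"
      by eventually_elim (rule h[symmetric], auto)
    have "R analytic_on {Complex 0 \<omega>}"
      using R by (auto simp: rhp_regular_def intro: analytic_on_subset)
    then have "isCont R (Complex 0 \<omega>)"
      by (rule analytic_at_imp_isCont)
    moreover have "((\<lambda>x. Complex x \<omega>) \<longlongrightarrow> Complex 0 \<omega>) (at_right 0)"
      by (intro tendsto_intros)
    ultimately have "((\<lambda>x. R (Complex x \<omega>)) \<longlongrightarrow> R (Complex 0 \<omega>)) (at_right 0)"
      by (rule isCont_tendsto_compose)
    then have "((\<lambda>x. h (Complex x \<omega>)) \<longlongrightarrow> R (Complex 0 \<omega>)) (at_right 0)"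
      using tendsto_cong[OF ev] by blast
    then show ?thesis unfolding bvalue_def by (intro tendsto_Lim) simp_all
  qed
  have "(LINT \<omega>|lborel. cnj (bvalue h \<omega>) * bvalue h \<omega>) = of_real (axis_energy R)"
  proof -
    have "cnj (bvalue h \<omega>) * bvalue h \<omega> = of_real (cmod (R (Complex 0 \<omega>)) ^ 2)" for \<omega>
      unfolding bv complex_norm_square by (rule mult.commute)
    then show ?thesis
      unfolding axis_energy_def by (simp only: integral_complex_of_real)
  qed
  then have "H2_rhp_inner h h = of_real (1 / (2 * pi) * axis_energy R)"
    unfolding H2_rhp_inner_def by (simp only: of_real_mult)
  then have "Re (H2_rhp_inner h h) = 1 / (2 * pi) * axis_energy R"
    by (simp only: Re_complex_of_real)
  then show ?thesis
    by (simp only: H2_rhp_norm_def times_divide_eq_left mult_1_left)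
qed

section \<open>Reproducing kernels\<close>

text \<open>The segment on the axis is closed by a half circle on the right. Quadratic decay beats
  the arc length \<open>pi * \<rho>\<close>, and \<rho> tends to infinity by dominated
  convergence.\<close>

lemma axis_integral_eq_0:
  fixes F :: "complex \<Rightarrow> complex"
  assumes hol: "F holomorphic_on {s. 0 \<le> Re s}"
    and bound: "\<And>s. 0 \<le> Re s \<Longrightarrow> \<rho>0 \<le> cmod s \<Longrightarrow> cmod (F s) \<le> C / cmod s ^ 2"
    and int: "integrable lborel (\<lambda>\<omega>. F (Complex 0 \<omega>))"
  shows "(LINT \<omega>|lborel. F (Complex 0 \<omega>)) = 0"
proof -
  have C: "0 \<le> C"
  proof -
    let ?s = "of_real (max \<rho>0 1)"
    have "0 \<le> cmod (F ?s) * cmod ?s ^ 2" by simp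
    also have "\<dots> \<le> C"
      using bound[of ?s] by (simp add: pos_le_divide_eq)
    finally show ?thesis .
  qed
  have part: "cmod (LINT \<omega>:{-\<rho>..\<rho>}|lborel. F (Complex 0 \<omega>)) \<le> C * pi / \<rho>"
    if \<rho>: "0 < \<rho>" "\<rho>0 \<le> \<rho>" for \<rho>
  proof -
    let ?l = "linepath (Complex 0 (- \<rho>)) (Complex 0 \<rho>)"
    \<comment> \<open>The angle decreases, so that the arc starts at the top end of the segment and
      returns to its bottom end.\<close>
    let ?c = "part_circlepath 0 \<rho> (pi / 2) (- (pi / 2))"
    have ends: "pathfinish ?l = pathstart ?c" "pathfinish ?c = pathstart ?l"
      by (simp_all add: part_circlepath_def linepath_def pathfinish_def pathstart_def complex_eq_iff Re_exp Im_exp)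
    have cim: "path_image ?c \<subseteq> {s. 0 \<le> Re s \<and> cmod s = \<rho>}"
      using \<rho> by (auto simp: path_image_part_circlepath' closed_segment_eq_real_ivl norm_mult
          intro!: mult_nonneg_nonneg cos_ge_zero)
    have lim: "path_image ?l \<subseteq> {s. 0 \<le> Re s}"
      by (auto simp: closed_segment_def)
    have convex: "convex {s::complex. 0 \<le> Re s}"
      by (rule convex_halfspace_Re_ge)
    have "(F has_contour_integral 0) (?l +++ ?c)"
      by (rule Cauchy_theorem_convex_simple[OF hol convex])
         (use ends lim cim in \<open>auto simp: path_image_join valid_path_join\<close>)
    moreover have cont: "continuous_on {s. 0 \<le> Re s} F"
      using hol by (rule holomorphic_on_imp_continuous_on)
    have il: "F contour_integrable_on ?l"
      by (rule contour_integrable_continuous_linepath, rule continuous_on_subset[OF cont])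
         (use lim in simp)
    have ic: "F contour_integrable_on ?c"
      by (rule contour_integrable_continuous_part_circlepath, rule continuous_on_subset[OF cont])
         (use cim in auto)
    ultimately have sum0: "contour_integral ?l F + contour_integral ?c F = 0"
      using contour_integral_join[OF il ic] ends contour_integral_unique by force
    have "cmod (contour_integral ?c F) \<le> C / \<rho> ^ 2 * \<rho> * \<bar>- (pi / 2) - pi / 2\<bar>"
    proof (rule contour_integral_bound_part_circlepath[OF ic])
      fix s assume "s \<in> path_image ?c"
      then show "cmod (F s) \<le> C / \<rho> ^ 2" using cim bound[of s] \<rho> by auto
    qed (use \<rho> C in auto)
    also have "\<dots> = C * pi / \<rho>"
      using \<rho> by (simp add: field_simps power2_eq_square)
    finally have le: "cmod (contour_integral ?l F) \<le> C * pi / \<rho>"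
      using sum0 by (metis add_eq_0_iff norm_minus_cancel)
    \<comment> \<open>Along the axis \<open>ds = \<i> * d\<omega>\<close>, whence the factor
      \<open>- \<i>\<close>, which does not affect the modulus.\<close>
    have "((\<lambda>x. F (Complex 0 x)) has_integral (- \<i> * contour_integral ?l F)) {- \<rho>..\<rho>}"
      using has_contour_integral_integral[OF il] \<rho>
      by (subst (asm) has_contour_integral_linepath_same_Re_iff) auto
    then have "integral {- \<rho>..\<rho>} (\<lambda>x. F (Complex 0 x)) = - \<i> * contour_integral ?l F"
      by (rule integral_unique)
    moreover have "set_integrable lborel {-\<rho>..\<rho>} (\<lambda>x. F (Complex 0 x))"
      using int unfolding set_integrable_def by (rule integrable_mult_indicator[rotated]) simp
    ultimately show ?thesis
      using le by (simp add: set_borel_integral_eq_integral norm_mult)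
  qed
  have "(\<lambda>n. LINT \<omega>:{- real n..real n}|lborel. F (Complex 0 \<omega>)) \<longlonglongrightarrow> (LINT \<omega>|lborel. F (Complex 0 \<omega>))"
    unfolding set_lebesgue_integral_def
  proof (rule integral_dominated_convergence[where w = "\<lambda>\<omega>. cmod (F (Complex 0 \<omega>))"])
    show "AE \<omega> in lborel. (\<lambda>n. indicator {- real n..real n} \<omega> *\<^sub>R F (Complex 0 \<omega>)) \<longlonglongrightarrow> F (Complex 0 \<omega>)"
    proof (rule AE_I2, rule tendsto_eventually)
      fix \<omega> :: real
      have "eventually (\<lambda>n. \<bar>\<omega>\<bar> \<le> real n) sequentially"
        by (meson eventually_at_top_linorder nat_ceiling_le_eq)
      then show "eventually (\<lambda>n. indicator {- real n..real n} \<omega> *\<^sub>R F (Complex 0 \<omega>) = F (Complex 0 \<omega>)) sequentially"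
        by eventually_elim (auto simp: indicator_def)
    qed
    show "AE \<omega> in lborel. cmod (indicator {- real n..real n} \<omega> *\<^sub>R F (Complex 0 \<omega>)) \<le> cmod (F (Complex 0 \<omega>))" for n
      by (rule AE_I2) (auto simp: indicator_def)
  qed (use int in \<open>auto intro: borel_measurable_integrable\<close>)
  moreover have "(\<lambda>n. LINT \<omega>:{- real n..real n}|lborel. F (Complex 0 \<omega>)) \<longlonglongrightarrow> 0"
  proof (rule Lim_null_comparison)
    have "eventually (\<lambda>n. max \<rho>0 1 \<le> real n) sequentially"
      by (meson eventually_at_top_linorder nat_ceiling_le_eq)
    then show "eventually (\<lambda>n. cmod (LINT \<omega>:{- real n..real n}|lborel. F (Complex 0 \<omega>)) \<le> C * pi / real n) sequentially"
      by eventually_elim (rule part; simp)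
    show "(\<lambda>n. C * pi / real n) \<longlonglongrightarrow> 0"
      by (rule lim_const_over_n)
  qed
  ultimately show ?thesis by (rule LIMSEQ_unique)
qed

text \<open>The integrand is a Cauchy density of width a centred at \<open>Im p\<close>; the
  substitution \<open>\<omega> = Im p + a * x\<close> reduces it to
  \<open>1 / (1 + x^2)\<close>.\<close>

lemma axis_energy_pole:
  assumes "Re p < 0"
  shows "axis_energy (\<lambda>s. 1 / (s - p)) = pi / (- Re p)"
proof -
  define a where "a = - Re p"
  have a: "a > 0" using assms by (simp add: a_def)
  have "cmod (1 / (Complex 0 (Im p + a * x) - p)) ^ 2 = inverse (1 + x ^ 2) / a ^ 2" for x
  proof -
    have "cmod (Complex 0 (Im p + a * x) - p) ^ 2 = a ^ 2 * (1 + x ^ 2)"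
      unfolding cmod_power2 by (simp add: a_def power2_eq_square algebra_simps)
    then show ?thesis by (simp add: norm_divide power_divide divide_simps)
  qed
  moreover have "axis_energy (\<lambda>s. 1 / (s - p)) = \<bar>a\<bar> *\<^sub>R (LINT x|lborel. cmod (1 / (Complex 0 (Im p + a * x) - p)) ^ 2)"
    unfolding axis_energy_def using a by (intro lborel_integral_real_affine) simp
  ultimately show ?thesis
    using a integrable_inverse_1_plus_square_lborel(2) by (simp add: a_def[symmetric] power2_eq_square)
qed

text \<open>On the axis the conjugate of \<open>s - p\<close> is \<open>- (s - w)\<close>, so the
  conjugated integrand is \<open>- R s / (s - w)\<close>. This extends holomorphically because the
  zero of R at w cancels the pole.\<close>

lemma axis_inner_pole_zero:
  assumes R: "rhp_regular R" and p: "Re p < 0" and zero: "R (- cnj p) = 0"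
  shows "axis_inner R (\<lambda>s. 1 / (s - p)) = 0"
proof -
  define w where "w = - cnj p"
  have w: "0 < Re w" using p by (simp add: w_def)
  \<comment> \<open>Keeping \<open>R w\<close>, which is 0, makes this the difference quotient,
    holomorphic also at w.\<close>
  define F where "F s = (if s = w then deriv R w else (R s - R w) / (s - w))" for s
  obtain C where C: "\<And>s. 0 \<le> Re s \<Longrightarrow> cmod (R s) * (1 + cmod s) \<le> C"
    using R unfolding rhp_regular_def by blast
  have Fax: "F (Complex 0 \<omega>) = - cnj (cnj (R (Complex 0 \<omega>)) * (1 / (Complex 0 \<omega> - p)))" for \<omega>
  proof -
    have "cnj (Complex 0 \<omega> - p) = - (Complex 0 \<omega> - w)"
      by (simp only: w_def complex_eq_iff) simp
    then have "cnj (cnj (R (Complex 0 \<omega>)) * (1 / (Complex 0 \<omega> - p))) = - (R (Complex 0 \<omega>) / (Complex 0 \<omega> - w))"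
      by (simp only: complex_cnj_mult complex_cnj_divide complex_cnj_cnj complex_cnj_one) (simp only: mult_1_right divide_minus_right times_divide_eq_right mult_minus_right)
    moreover have "Complex 0 \<omega> \<noteq> w" using w by auto
    ultimately show ?thesis
      using zero by (simp only: F_def w_def[symmetric]) simp
  qed
  have "(LINT \<omega>|lborel. F (Complex 0 \<omega>)) = 0"
  proof (rule axis_integral_eq_0)
    have "w \<in> interior {s. 0 \<le> Re s}"
      using w open_halfspace_Re_gt[of 0] by (intro interiorI[of "{s. 0 < Re s}"]) auto
    moreover have "R holomorphic_on {s. 0 \<le> Re s}"
      using R by (auto simp: rhp_regular_def dest: analytic_imp_holomorphic)
    ultimately show "F holomorphic_on {s. 0 \<le> Re s}"
      unfolding F_def by (intro pole_lemma)
    \<comment> \<open>Beyond twice the modulus of w the distance to w is at least half of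
      \<open>cmod s\<close>; this is the 2 in the bound, and the extra 1 keeps s away from
      0.\<close>
    show "cmod (F s) \<le> 2 * C / cmod s ^ 2" if s: "0 \<le> Re s" "2 * cmod w + 1 \<le> cmod s" for s
    proof -
      have far: "cmod s / 2 \<le> cmod (s - w)" "s \<noteq> w" "cmod s > 0"
        using s norm_triangle_ineq2[of s w] norm_ge_zero[of w] by (auto simp del: norm_ge_zero)
      have "cmod (R s) * cmod s \<le> C"
        using C[OF s(1)] by (smt (verit) norm_ge_zero mult_left_mono)
      then have "cmod (R s) / (cmod s / 2) \<le> C / cmod s / (cmod s / 2)"
        using far by (intro divide_right_mono) (auto simp: pos_le_divide_eq)
      moreover have "cmod (F s) \<le> cmod (R s) / (cmod s / 2)"
      proof -
        have "cmod (F s) = cmod (R s) / cmod (s - w)"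
          using far zero by (simp add: F_def norm_divide w_def)
        also have "\<dots> \<le> cmod (R s) / (cmod s / 2)"
          using far by (intro divide_left_mono) auto
        finally show ?thesis .
      qed
      ultimately show ?thesis by (simp add: power2_eq_square mult.commute)
    qed
    show "integrable lborel (\<lambda>\<omega>. F (Complex 0 \<omega>))"
      unfolding Fax
      by (intro integrable_minus integrable_cnj integrable_axis_inner[OF R rhp_regular_pole[OF p]])
  qed
  then show ?thesis
    unfolding Fax axis_inner_def Bochner_Integration.integral_minus Bochner_Integration.integral_cnj
    by (simp only: neg_equal_0_iff_equal complex_cnj_zero_iff)
qed

text \<open>Subtracting a multiple of the Poisson kernel removes the value at \<open>- cnj p\<close>, so that Cauchy's
  integral theorem applies and no winding number is needed.\<close>

lemma axis_inner_pole:
  assumes R: "rhp_regular R" and p: "Re p < 0"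
  shows "axis_inner R (\<lambda>s. 1 / (s - p)) = 2 * pi * cnj (R (- cnj p))"
proof -
  let ?u = "\<lambda>s. 1 / (s - p)"
  \<comment> \<open>At \<open>- cnj p\<close> the kernel has the value
    \<open>1 / (- 2 * Re p)\<close>, so c times the kernel has the same value there as R. With
    kernel energy \<open>pi / (- Re p)\<close>, the subtracted part returns
    \<open>2 * pi * cnj (R (- cnj p))\<close>.\<close>
  define c where "c = R (- cnj p) * (- 2 * Re p)"
  note u = rhp_regular_pole[OF p]
  have "axis_inner (\<lambda>s. R s - c * ?u s) ?u = 0"
  proof (rule axis_inner_pole_zero[OF rhp_regular_diff[OF R rhp_regular_cmult[OF u]] p])
    have "- cnj p - p = - 2 * Re p" by (simp add: complex_eq_iff)
    then show "R (- cnj p) - c * ?u (- cnj p) = 0" using p by (simp add: c_def)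
  qed
  moreover have "axis_inner (\<lambda>s. R s - c * ?u s) ?u = axis_inner R ?u - cnj c * axis_inner ?u ?u"
    unfolding axis_inner_def
    using integrable_axis_inner[OF R u] integrable_axis_inner[OF u u]
    by (simp only: left_diff_distrib complex_cnj_diff complex_cnj_mult mult.assoc
        Bochner_Integration.integral_diff integrable_mult_right integral_mult_right_zero)
  moreover have "axis_inner ?u ?u = of_real (axis_energy ?u)"
    unfolding axis_inner_def axis_energy_def integral_complex_of_real[symmetric] complex_norm_square
    by (simp add: mult.commute)
  ultimately show ?thesis
    using p by (simp add: axis_energy_pole c_def)
qed

section \<open>Rational functions in the Hardy space\<close>

text \<open>One M serves all vertical lines; a function that is too large on segments, near the axis
  or far out, is thus not in the space.\<close>

lemma H2_rhp_average_bound: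
  assumes "h \<in> H2_rhp"
  obtains M where "\<And>x a b k. 0 < x \<Longrightarrow> a \<le> b \<Longrightarrow> 0 \<le> k \<Longrightarrow>
     (\<And>\<omega>. \<omega> \<in> {a..b} \<Longrightarrow> k \<le> cmod (h (Complex x \<omega>)) ^ 2) \<Longrightarrow> k * (b - a) \<le> M"
proof -
  define M where "M = (SUP x\<in>{0<..}. \<integral>\<^sup>+ \<omega>. ennreal (cmod (h (Complex x \<omega>)) ^ 2) \<partial>lborel)"
  have M: "M < \<infinity>" using assms by (simp add: H2_rhp_def M_def)
  show ?thesis
  proof
    fix x a b k :: real
    assume x: "0 < x" and ab: "a \<le> b" and k: "0 \<le> k"
      and le: "\<And>\<omega>. \<omega> \<in> {a..b} \<Longrightarrow> k \<le> cmod (h (Complex x \<omega>)) ^ 2"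
    have "ennreal (k * (b - a)) = ennreal k * emeasure lborel {a..b}"
      using ab k by (simp add: ennreal_mult)
    also have "\<dots> = (\<integral>\<^sup>+ \<omega>. ennreal k * indicator {a..b} \<omega> \<partial>lborel)"
      by (simp add: nn_integral_cmult_indicator)
    also have "\<dots> \<le> (\<integral>\<^sup>+ \<omega>. ennreal (cmod (h (Complex x \<omega>)) ^ 2) \<partial>lborel)"
      using le by (intro nn_integral_mono) (auto simp: indicator_def intro!: ennreal_leI)
    also have "\<dots> \<le> M"
      unfolding M_def using x by (intro SUP_upper) simp
    finally show "k * (b - a) \<le> enn2real M"
      using M ab k by (subst ennreal_le_iff[symmetric]) (simp_all add: less_top[symmetric])
  qed
qed

text \<open>An uncancelled pole at z makes \<open>cmod (h s)\<close> at least a constant over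
  \<open>cmod (s - z)\<close>. On the segment of length 2x at distance x from z, the integral of the
  square is then at least c/x, which is unbounded.\<close>

lemma H2_rhp_no_axis_pole:
  assumes h: "h \<in> H2_rhp" and eq: "\<And>s. 0 < Re s \<Longrightarrow> h s = poly P s / poly Q s"
    and Q: "\<And>s. 0 < Re s \<Longrightarrow> poly Q s \<noteq> 0" and z: "Re z = 0" "poly Q z = 0"
  shows "poly P z = 0"
proof (rule ccontr)
  assume Pz: "poly P z \<noteq> 0"
  obtain M where M: "\<And>x a b k. 0 < x \<Longrightarrow> a \<le> b \<Longrightarrow> 0 \<le> k \<Longrightarrow>
     (\<And>\<omega>. \<omega> \<in> {a..b} \<Longrightarrow> k \<le> cmod (h (Complex x \<omega>)) ^ 2) \<Longrightarrow> k * (b - a) \<le> M"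
    using H2_rhp_average_bound[OF h] by blast
  obtain Q2 where Q2: "Q = [:- z, 1:] * Q2"
    using z(2) by (auto simp: poly_eq_0_iff_dvd)
  define m where "m = cmod (poly P z) / 2"
  \<comment> \<open>The summand 1 keeps B positive when z is a multiple root, where Q2 vanishes too;
    the lower bound for h is then even more generous.\<close>
  define B where "B = cmod (poly Q2 z) + 1"
  have mB: "m > 0" "B > 0" using Pz by (auto simp: m_def B_def add_nonneg_pos)
  have "eventually (\<lambda>s. m < cmod (poly P s)) (nhds z)"
    using Pz by (intro order_tendstoD(1)[OF tendsto_norm[OF isCont_tendsto_compose[OF poly_isCont filterlim_ident]]])
       (simp add: m_def)
  moreover have "eventually (\<lambda>s. cmod (poly Q2 s) < B) (nhds z)"
    by (intro order_tendstoD(2)[OF tendsto_norm[OF isCont_tendsto_compose[OF poly_isCont filterlim_ident]]])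
       (simp add: B_def)
  ultimately have "eventually (\<lambda>s. m < cmod (poly P s) \<and> cmod (poly Q2 s) < B) (nhds z)"
    by eventually_elim simp
  then obtain \<delta> where \<delta>: "\<delta> > 0" "\<And>s. dist s z < \<delta> \<Longrightarrow> m < cmod (poly P s) \<and> cmod (poly Q2 s) < B"
    unfolding eventually_nhds_metric by blast
  have low: "(m / B) ^ 2 / cmod (s - z) ^ 2 \<le> cmod (h s) ^ 2" if "0 < Re s" "cmod (s - z) < \<delta>" for s
  proof -
    have nz: "cmod (poly Q2 s) > 0" "s \<noteq> z" using Q[OF that(1)] by (auto simp: Q2)
    have "m / B / cmod (s - z) \<le> cmod (poly P s) / cmod (poly Q2 s) / cmod (s - z)"
      using \<delta>(2)[of s] that(2) nz mB by (intro divide_right_mono frac_le) (auto simp: dist_norm)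
    also have "\<dots> = cmod (h s)"
      unfolding eq[OF that(1)] Q2 norm_divide poly_mult norm_mult by (simp add: divide_divide_eq_left)
    finally show ?thesis
      using mB by (simp flip: power_divide add: power_mono)
  qed
  define c where "c = (m / B) ^ 2"
  have c: "c > 0" using mB by (simp add: c_def)
  have small: "c / x \<le> M" if x: "0 < x" "2 * x < \<delta>" for x
  proof -
    have "c / (2 * x ^ 2) * ((Im z + x) - (Im z - x)) \<le> M"
    proof (rule M[OF x(1)])
      fix \<omega> assume \<omega>: "\<omega> \<in> {Im z - x..Im z + x}"
      have dist2: "cmod (Complex x \<omega> - z) ^ 2 = x ^ 2 + (\<omega> - Im z) ^ 2"
        unfolding cmod_power2 using z by simp
      have "\<bar>\<omega> - Im z\<bar> ^ 2 \<le> x ^ 2"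
        using \<omega> by (intro power_mono) auto
      then have le: "cmod (Complex x \<omega> - z) ^ 2 \<le> 2 * x ^ 2"
        unfolding dist2 by simp
      also have "\<dots> \<le> (2 * x) ^ 2" by (simp add: power_mult_distrib)
      finally have "cmod (Complex x \<omega> - z) \<le> 2 * x"
        by (rule power2_le_imp_le) (use x in simp)
      then have "c / cmod (Complex x \<omega> - z) ^ 2 \<le> cmod (h (Complex x \<omega>)) ^ 2"
        unfolding c_def using x by (intro low) auto
      moreover have "c / (2 * x ^ 2) \<le> c / cmod (Complex x \<omega> - z) ^ 2"
        using le c x unfolding dist2 by (intro divide_left_mono) (auto simp: add_pos_nonneg)
      ultimately show "c / (2 * x ^ 2) \<le> cmod (h (Complex x \<omega>)) ^ 2" by linarith
    qed (use x c in auto)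
    then show ?thesis using x by (simp add: power2_eq_square)
  qed
  \<comment> \<open>The second bound gives \<open>x * (\<bar>M\<bar> + 1) \<le> c\<close>, which
    contradicts \<open>c \<le> M * x\<close>; the first keeps the segment in the neighbourhood of
    z.\<close>
  define x where "x = min (\<delta> / 4) (c / (\<bar>M\<bar> + 1))"
  have x: "0 < x" "2 * x < \<delta>" using \<delta> c by (auto simp: x_def min_less_iff_disj)
  have "x * (\<bar>M\<bar> + 1) \<le> c"
    by (simp add: x_def min_le_iff_disj flip: pos_le_divide_eq)
  moreover have "c \<le> M * x" using small[OF x] x by (simp add: pos_divide_le_eq)
  moreover have "M * x \<le> \<bar>M\<bar> * x" using x by (intro mult_right_mono) auto
  moreover have "x * (\<bar>M\<bar> + 1) = \<bar>M\<bar> * x + x" by (simp add: algebra_simps)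
  ultimately show False using x by linarith
qed

text \<open>Otherwise \<open>cmod (h s)\<close> stays above a positive constant near infinity, and
  the integral over the line \<open>Re s = 1\<close> diverges.\<close>

lemma H2_rhp_proper:
  assumes h: "h \<in> H2_rhp" and eq: "\<And>s. 0 < Re s \<Longrightarrow> h s = poly P s / poly Q s"
    and nz: "P \<noteq> 0" "Q \<noteq> 0"
  shows "degree P < degree Q"
proof (rule ccontr)
  assume deg: "\<not> degree P < degree Q"
  obtain M where M: "\<And>x a b k. 0 < x \<Longrightarrow> a \<le> b \<Longrightarrow> 0 \<le> k \<Longrightarrow>
     (\<And>\<omega>. \<omega> \<in> {a..b} \<Longrightarrow> k \<le> cmod (h (Complex x \<omega>)) ^ 2) \<Longrightarrow> k * (b - a) \<le> M"
    using H2_rhp_average_bound[OF h] by blast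
  define c where "c = cmod (lead_coeff P) / 2 / (cmod (lead_coeff Q) + 1)"
  have c: "c > 0" using nz by (auto simp: c_def add_nonneg_pos intro!: divide_pos_pos)
  have "eventually (\<lambda>s::complex. 1 \<le> cmod s) at_infinity"
    by (auto simp: eventually_at_infinity)
  with poly_norm_bounds_at_infinity[of P] poly_norm_bounds_at_infinity[of Q]
  have "eventually (\<lambda>s. c * cmod (poly Q s) \<le> cmod (poly P s)) at_infinity"
  proof eventually_elim
    case (elim s)
    have "c * cmod (poly Q s) \<le> c * ((cmod (lead_coeff Q) + 1) * cmod s ^ degree Q)"
      using elim c by (intro mult_left_mono) auto
    also have "\<dots> \<le> c * ((cmod (lead_coeff Q) + 1) * cmod s ^ degree P)"
      using elim c deg by (intro mult_left_mono power_increasing) auto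
    also have "\<dots> = cmod (lead_coeff P) / 2 * cmod s ^ degree P"
      using add_nonneg_pos[OF norm_ge_zero zero_less_one, of "lead_coeff Q"]
      by (simp add: c_def field_simps)
    finally show ?case using elim by simp
  qed
  moreover have "eventually (\<lambda>s. poly Q s \<noteq> 0) at_infinity"
  proof -
    obtain B where "\<And>s. poly Q s = 0 \<Longrightarrow> cmod s \<le> B"
      using finite_imp_bounded[OF poly_roots_finite[OF nz(2)]] by (auto simp: bounded_iff)
    then show ?thesis
      unfolding eventually_at_infinity by (intro exI[of _ "B + 1"]) force
  qed
  ultimately have "eventually (\<lambda>s. c \<le> cmod (poly P s / poly Q s)) at_infinity"
    by eventually_elim (simp add: norm_divide pos_le_divide_eq)
  then obtain \<rho> where \<rho>: "\<And>s. \<rho> \<le> cmod s \<Longrightarrow> c \<le> cmod (poly P s / poly Q s)"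
    by (auto simp: eventually_at_infinity)
  have "c ^ 2 * ((\<bar>\<rho>\<bar> + L) - \<bar>\<rho>\<bar>) \<le> M" if "L \<ge> 0" for L
  proof (rule M[of 1])
    fix \<omega> assume "\<omega> \<in> {\<bar>\<rho>\<bar>..\<bar>\<rho>\<bar> + L}"
    then have "\<rho> \<le> cmod (Complex 1 \<omega>)"
      using abs_Im_le_cmod[of "Complex 1 \<omega>"] by auto
    then show "c ^ 2 \<le> cmod (h (Complex 1 \<omega>)) ^ 2"
      using c by (intro power_mono) (auto simp: eq \<rho>)
  qed (use that in auto)
  \<comment> \<open>For a segment of this length the bound reads
    \<open>\<bar>M\<bar> + 1 \<le> M\<close>.\<close>
  from this[of "(\<bar>M\<bar> + 1) / c ^ 2"] show False using c by (simp split: if_splits)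
qed

text \<open>After cancellation, a zero of the denominator in the open half plane would be a zero of
  the numerator, because h is finite there. The two preceding lemmas exclude zeros on the axis and
  improper fractions.\<close>

lemma H2_rhp_rational:
  fixes P Q :: "complex poly"
  assumes h: "h \<in> H2_rhp" and Q: "Q \<noteq> 0"
    and fin: "finite {s. 0 < Re s \<and> h s \<noteq> poly P s / poly Q s}"
  obtains R where "rhp_regular R" "\<And>s. 0 < Re s \<Longrightarrow> h s = R s"
proof -
  \<comment> \<open>A denominator of least degree stands for the reduced fraction: a common root
    could be divided out.\<close>
  obtain P' Q' where Q': "Q' \<noteq> 0" and PQ: "P' * Q = P * Q'"
    and least: "\<And>P2 Q2. Q2 \<noteq> 0 \<Longrightarrow> P2 * Q = P * Q2 \<Longrightarrow> degree Q' \<le> degree Q2"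
    using ex_has_least_nat[of "\<lambda>(P', Q'). Q' \<noteq> 0 \<and> P' * Q = P * Q'" "(P, Q)" "\<lambda>(P', Q'). degree Q'"] Q
    by auto
  have common: "poly P' s \<noteq> 0" if "poly Q' s = 0" for s
  proof
    assume "poly P' s = 0"
    with that obtain P2 Q2 where 2: "P' = [:- s, 1:] * P2" "Q' = [:- s, 1:] * Q2"
      by (auto simp: poly_eq_0_iff_dvd elim!: dvdE)
    have "[:- s, 1:] * (P2 * Q) = [:- s, 1:] * (P * Q2)"
      using PQ unfolding 2 by (simp only: mult_ac)
    then have "P2 * Q = P * Q2" by (subst (asm) mult_left_cancel) auto
    moreover have "Q2 \<noteq> 0" using Q' 2 by auto
    moreover from this have "degree Q' = Suc (degree Q2)"
      unfolding 2 by (subst degree_mult_eq) auto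
    ultimately show False using least[of Q2 P2] by simp
  qed
  define E where "E = {s. 0 < Re s \<and> h s \<noteq> poly P s / poly Q s} \<union> {s. poly Q s = 0}"
  have finE: "finite E" using fin poly_roots_finite[OF Q] by (simp add: E_def)
  have off: "h s * poly Q' s = poly P' s" if "0 < Re s" "s \<notin> E" for s
  proof -
    have "h s = poly P s / poly Q s" "poly Q s \<noteq> 0" using that by (auto simp: E_def)
    moreover have "poly P' s * poly Q s = poly P s * poly Q' s"
      using PQ by (metis poly_mult)
    ultimately have "poly Q s * (h s * poly Q' s) = poly Q s * poly P' s"
      by (simp add: mult.commute)
    then show ?thesis using \<open>poly Q s \<noteq> 0\<close> by simp
  qed
  have eq: "h s * poly Q' s = poly P' s" if s: "0 < Re s" for s
  proof -
    have "open {s::complex. 0 < Re s}" by (rule open_halfspace_Re_gt)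
    then have "isCont h s"
      using h s holomorphic_on_imp_continuous_on[of h "{s. 0 < Re s}"]
      by (auto simp: H2_rhp_def continuous_on_eq_continuous_at)
    \<comment> \<open>Multiplied out, the identity is one between continuous functions and so
      extends across the finite set E.\<close>
    then have "((\<lambda>t. h t * poly Q' t - poly P' t) \<longlongrightarrow> h s * poly Q' s - poly P' s) (at s)"
      by (intro tendsto_intros) (auto simp: isCont_def intro!: poly_isCont[unfolded isCont_def])
    moreover have "eventually (\<lambda>t. t \<in> {s. 0 < Re s} - (E - {s})) (at s)"
      using \<open>open _\<close> finE s by (intro eventually_at_in_open' open_Diff finite_imp_closed) auto
    then have "eventually (\<lambda>t. h t * poly Q' t - poly P' t = 0) (at s)"
      using eventually_neq_at_within[of s s UNIV] by eventually_elim (auto simp: off)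
    ultimately show ?thesis
      using tendsto_unique[OF trivial_limit_at _ tendsto_eventually] by fastforce
  qed
  have nzQ: "poly Q' s \<noteq> 0" if "0 < Re s" for s
    using common eq[OF that] by fastforce
  have quot: "h s = poly P' s / poly Q' s" if "0 < Re s" for s
    using nzQ[OF that] eq[OF that] by (simp add: field_simps)
  show ?thesis
  proof (cases "P' = 0")
    case True
    show ?thesis
      by (rule that[of "\<lambda>s. 0"]) (use quot True in \<open>auto simp: rhp_regular_def\<close>)
  next
    case False
    have "poly Q' s \<noteq> 0" if "0 \<le> Re s" for s
      using that nzQ[of s] H2_rhp_no_axis_pole[OF h quot nzQ, of s] common[of s]
      by (cases "Re s = 0") auto
    then have "rhp_regular (\<lambda>s. poly P' s / poly Q' s)"
      by (intro rhp_regular_poly_divide H2_rhp_proper[OF h quot False Q'])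
    then show ?thesis using quot by (rule that)
  qed
qed

section \<open>Rational functions up to finitely many values\<close>

definition rational_fun :: "(complex \<Rightarrow> complex) \<Rightarrow> bool" where
  "rational_fun f \<longleftrightarrow> (\<exists>P Q. Q \<noteq> 0 \<and> finite {s. f s \<noteq> poly P s / poly Q s})"

lemma rational_funI:
  assumes "Q \<noteq> 0" "finite E" "\<And>s. s \<notin> E \<Longrightarrow> f s = poly P s / poly Q s"
  shows "rational_fun f"
  unfolding rational_fun_def using assms
  by (intro exI[of _ P] exI[of _ Q] conjI) (auto intro: finite_subset[of _ E])

text \<open>Putting the zeros of the denominator into the exceptional set permits genuine fraction
  arithmetic outside of it.\<close>

lemma rational_funE:
  assumes "rational_fun f"
  obtains P Q E where "Q \<noteq> 0" "finite E" "\<And>s. s \<notin> E \<Longrightarrow> f s = poly P s / poly Q s \<and> poly Q s \<noteq> 0"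
proof -
  obtain P Q where PQ: "Q \<noteq> 0" "finite {s. f s \<noteq> poly P s / poly Q s}"
    using assms by (auto simp: rational_fun_def)
  show ?thesis
    by (rule that[of Q "{s. f s \<noteq> poly P s / poly Q s} \<union> {s. poly Q s = 0}" P])
       (use PQ poly_roots_finite in auto)
qed

text \<open>This absorbs dummy values at poles, such as results of division by zero or values set by
  \<open>remove_sings\<close>.\<close>

lemma rational_fun_cong:
  assumes "rational_fun f" "finite E" "\<And>s. s \<notin> E \<Longrightarrow> g s = f s"
  shows "rational_fun g"
proof -
  obtain P Q E' where f: "Q \<noteq> 0" "finite E'" "\<And>s. s \<notin> E' \<Longrightarrow> f s = poly P s / poly Q s \<and> poly Q s \<noteq> 0"
    using rational_funE[OF assms(1)] by metis
  show ?thesis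
    by (rule rational_funI[OF f(1), of "E \<union> E'" _ P]) (use assms f in auto)
qed

lemma rational_fun_poly: "rational_fun (\<lambda>s. poly P s)"
  by (rule rational_funI[of 1 "{}" _ P]) auto

lemma rational_fun_const: "rational_fun (\<lambda>s. c)"
  using rational_fun_poly[of "[:c:]"] by simp

lemma rational_fun_ident: "rational_fun (\<lambda>s. s)"
  using rational_fun_poly[of "[:0, 1:]"] by simp

lemma rational_fun_add:
  assumes "rational_fun f" "rational_fun g"
  shows "rational_fun (\<lambda>s. f s + g s)"
proof -
  obtain P Q E where f: "Q \<noteq> 0" "finite E" "\<And>s. s \<notin> E \<Longrightarrow> f s = poly P s / poly Q s \<and> poly Q s \<noteq> 0"
    using rational_funE[OF assms(1)] by metis
  obtain P' Q' E' where g: "Q' \<noteq> 0" "finite E'" "\<And>s. s \<notin> E' \<Longrightarrow> g s = poly P' s / poly Q' s \<and> poly Q' s \<noteq> 0"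
    using rational_funE[OF assms(2)] by metis
  show ?thesis
    by (rule rational_funI[of "Q * Q'" "E \<union> E'" _ "P * Q' + P' * Q"])
       (use f g in \<open>auto simp: add_frac_eq\<close>)
qed

lemma rational_fun_mult:
  assumes "rational_fun f" "rational_fun g"
  shows "rational_fun (\<lambda>s. f s * g s)"
proof -
  obtain P Q E where f: "Q \<noteq> 0" "finite E" "\<And>s. s \<notin> E \<Longrightarrow> f s = poly P s / poly Q s \<and> poly Q s \<noteq> 0"
    using rational_funE[OF assms(1)] by metis
  obtain P' Q' E' where g: "Q' \<noteq> 0" "finite E'" "\<And>s. s \<notin> E' \<Longrightarrow> g s = poly P' s / poly Q' s \<and> poly Q' s \<noteq> 0"
    using rational_funE[OF assms(2)] by metis
  show ?thesis
    by (rule rational_funI[of "Q * Q'" "E \<union> E'" _ "P * P'"]) (use f g in auto)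
qed

lemma rational_fun_inverse:
  assumes "rational_fun f"
  shows "rational_fun (\<lambda>s. inverse (f s))"
proof -
  obtain P Q E where f: "Q \<noteq> 0" "finite E" "\<And>s. s \<notin> E \<Longrightarrow> f s = poly P s / poly Q s \<and> poly Q s \<noteq> 0"
    using rational_funE[OF assms(1)] by metis
  show ?thesis
  proof (cases "P = 0")
    case True
    then show ?thesis
      by (intro rational_fun_cong[OF rational_fun_const[of 0] f(2)]) (use f(3) in auto)
  next
    case False
    then show ?thesis
      by (intro rational_funI[OF _ f(2), of P _ Q]) (use f(3) in auto)
  qed
qed

lemma rational_fun_divide:
  assumes "rational_fun f" "rational_fun g"
  shows "rational_fun (\<lambda>s. f s / g s)"
  unfolding divide_inverse by (intro rational_fun_mult rational_fun_inverse assms)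

lemma rational_fun_sum:
  "(\<And>i. i \<in> I \<Longrightarrow> rational_fun (f i)) \<Longrightarrow> rational_fun (\<lambda>s. \<Sum>i\<in>I. f i s)"
  by (induction I rule: infinite_finite_induct) (auto intro: rational_fun_add rational_fun_const)

lemma rational_fun_prod:
  "(\<And>i. i \<in> I \<Longrightarrow> rational_fun (f i)) \<Longrightarrow> rational_fun (\<lambda>s. \<Prod>i\<in>I. f i s)"
  by (induction I rule: infinite_finite_induct) (auto intro: rational_fun_mult rational_fun_const)

lemma rational_fun_poly_comp:
  assumes "rational_fun f"
  shows "rational_fun (\<lambda>s. poly P (f s))"
proof (induction P)
  case (pCons a P)
  then show ?case by (simp add: rational_fun_add rational_fun_mult rational_fun_const assms)
qed (simp add: rational_fun_const)

text \<open>A rational function vanishes either at all but finitely many points or at only finitely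
  many, so up to a finite set one branch is always taken. It serves the case of a zero determinant
  in Cramer's rule.\<close>

lemma rational_fun_if_zero:
  assumes f: "rational_fun f" and gh: "rational_fun g" "rational_fun h"
  shows "rational_fun (\<lambda>s. if f s = 0 then g s else h s)"
proof -
  obtain P Q E where PQ: "Q \<noteq> 0" "finite E" "\<And>s. s \<notin> E \<Longrightarrow> f s = poly P s / poly Q s \<and> poly Q s \<noteq> 0"
    using rational_funE[OF f] by metis
  show ?thesis
  proof (cases "P = 0")
    case True
    then show ?thesis by (intro rational_fun_cong[OF gh(1) PQ(2)]) (use PQ(3) in auto)
  next
    case False
    show ?thesis
      by (rule rational_fun_cong[OF gh(2), of "E \<union> {s. poly P s = 0}"])
         (use PQ(2,3) poly_roots_finite[OF False] in auto)
  qed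
qed

lemma rational_fun_remove_sings:
  assumes "rational_fun f"
  shows "rational_fun (remove_sings f)"
proof -
  obtain P Q E where f: "Q \<noteq> 0" "finite E" "\<And>s. s \<notin> E \<Longrightarrow> f s = poly P s / poly Q s \<and> poly Q s \<noteq> 0"
    using rational_funE[OF assms] by metis
  have "open (- E)" using f(2) finite_imp_closed by auto
  moreover have "(\<lambda>s. poly P s / poly Q s) holomorphic_on - E"
    using f(3) by (intro holomorphic_intros) auto
  then have "f holomorphic_on - E"
    using f(3) by (subst holomorphic_cong[OF refl]) auto
  ultimately have "f analytic_on {s}" if "s \<notin> E" for s
    using that analytic_on_open analytic_on_subset[of f "- E" "{s}"] by auto
  then show ?thesis
    by (intro rational_fun_cong[OF assms f(2)]) simp
qed

section \<open>Rationality of transfer functions\<close>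

lemma rational_fun_det:
  fixes F :: "complex \<Rightarrow> complex^'k^'k"
  assumes "\<And>i j. rational_fun (\<lambda>s. F s $ i $ j)"
  shows "rational_fun (\<lambda>s. det (F s))"
  unfolding det_def
  by (intro rational_fun_sum rational_fun_mult rational_fun_const rational_fun_prod assms)

text \<open>\<^const>\<open>matrix_inv\<close> has one fixed junk value at all singular matrices, so that rationality does not
  require the determinant to be nonzero somewhere.\<close>

lemma matrix_inv_not_invertible:
  assumes "\<not> invertible M"
  shows "matrix_inv M = (SOME N. False)"
proof -
  have "(\<lambda>N. M ** N = mat 1 \<and> N ** M = mat 1) = (\<lambda>N. False)"
    using assms by (auto simp: invertible_def)
  then show ?thesis by (simp add: matrix_inv_def)
qed

lemma matrix_inv_right_inverse:
  assumes "invertible M"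
  shows "M ** matrix_inv M = mat 1"
  using someI_ex[OF assms[unfolded invertible_def]] by (simp add: matrix_inv_def)

lemma rational_fun_transfer_fun:
  fixes M :: "complex^'k^'k" and b c :: "complex^'k"
  shows "rational_fun (transfer_fun M b c)"
proof -
  let ?D = "\<lambda>s. det (mat s - M)"
  let ?C = "\<lambda>k s. det (\<chi> i j. if j = k then b $ i else (mat s - M) $ i $ j)"
  have entry: "rational_fun (\<lambda>s. (mat s - M) $ i $ j)" for i j
    using rational_fun_add[OF rational_fun_ident rational_fun_const[of "- M $ i $ j"]]
      rational_fun_const[of "- M $ i $ j"] by (cases "i = j") (simp_all add: mat_def)
  have D: "rational_fun ?D" by (rule rational_fun_det[OF entry])
  have C: "rational_fun (?C k)" for k
  proof (rule rational_fun_det)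
    fix i j
    show "rational_fun (\<lambda>s. (\<chi> i j. if j = k then b $ i else (mat s - M) $ i $ j) $ i $ j)"
      using entry rational_fun_const by (cases "j = k") (simp_all del: vector_minus_component)
  qed
  \<comment> \<open>Cramer's rule off the spectrum of M; on the spectrum the junk inverse
    contributes a constant independent of s.\<close>
  have cramer': "(matrix_inv (mat s - M) *v b) $ i = (if ?D s = 0 then ((SOME N::complex^'k^'k. False) *v b) $ i
      else ?C i s / ?D s)" for s i
  proof (cases "?D s = 0")
    case True
    then have "matrix_inv (mat s - M) = (SOME N. False)"
      by (intro matrix_inv_not_invertible) (simp add: invertible_det_nz)
    then show ?thesis using True by simp
  next
    case False
    then have "(mat s - M) *v (matrix_inv (mat s - M) *v b) = b"
      by (simp add: matrix_vector_mul_assoc matrix_inv_right_inverse invertible_det_nz)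
    from iffD1[OF cramer[OF False] this] show ?thesis
      using False by (simp only: vec_lambda_beta if_False)
  qed
  have "rational_fun (\<lambda>s. \<Sum>i\<in>UNIV. cnj (c $ i) * (matrix_inv (mat s - M) *v b) $ i)"
    unfolding cramer'
    by (intro rational_fun_sum rational_fun_mult rational_fun_const rational_fun_if_zero D
        rational_fun_divide C)
  then show ?thesis
    unfolding transfer_fun_def by (rule rational_fun_remove_sings)
qed

section \<open>Residue regularity forces a Moebius transformation\<close>

locale regular_setting =
  fixes \<psi> q :: "complex \<Rightarrow> complex" and X A :: "complex set"
  assumes setting: "conformal_setting \<psi> X A"
    and root: "sqrt_deriv \<psi> q" and q_analytic: "q analytic_on X"
    and regular: "residue_regular \<psi> q X A"
begin

lemmas settingD = conformal_settingD[OF setting]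

lemma analytic_at_nonpole: "\<not> is_pole \<psi> s \<Longrightarrow> \<psi> analytic_on {s}"
  using nicely_meromorphic_on_imp_analytic_at[OF settingD(1)] by simp

lemma eventually_nonpole: "eventually (\<lambda>t. \<not> is_pole \<psi> t) (at s)"
proof -
  have "isolated_singularity_at \<psi> s"
    using settingD(1) meromorphic_on_subset[of \<psi> UNIV "{s}"]
    by (auto simp: nicely_meromorphic_on_def intro: meromorphic_on_isolated_singularity)
  then obtain r where "r > 0" "\<psi> analytic_on ball s r - {s}"
    by (auto simp: isolated_singularity_at_def)
  then have "\<not> is_pole \<psi> t" if "t \<noteq> s" "dist t s < r" for t
    using that analytic_on_analytic_at[of \<psi> "ball s r - {s}"] analytic_at_imp_no_pole[of \<psi> t]
    by (auto simp: dist_commute)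
  with \<open>r > 0\<close> show ?thesis by (auto simp: eventually_at)
qed

lemma q_nonzero: "z \<in> X \<Longrightarrow> q z \<noteq> 0" and nonpole_X: "z \<in> X \<Longrightarrow> \<not> is_pole \<psi> z"
proof -
  show np: "z \<in> X \<Longrightarrow> \<not> is_pole \<psi> z"
    using settingD(4) analytic_at_imp_no_pole by blast
  show "z \<in> X \<Longrightarrow> q z \<noteq> 0"
    using np settingD(5)[of z] root unfolding sqrt_deriv_def by force
qed

text \<open>The two clauses of \<open>residue_regular\<close> cover the plane: Hardy space
  membership the open right half, the analyticity clause the closed left half without the point over
  \<mu>.\<close>

lemma kernel_holomorphic:
  assumes "\<mu> \<in> A"
  shows "hfrak \<psi> q (\<lambda>s. 1 / (s - \<mu>)) holomorphic_on - {psi_inv \<psi> X \<mu>}"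
proof -
  let ?g = "hfrak \<psi> q (\<lambda>s. 1 / (s - \<mu>))"
  have g: "?g holomorphic_on {s. 0 < Re s}" "?g analytic_on {s. Re s \<le> 0} - {psi_inv \<psi> X \<mu>}"
    using regular assms by (auto simp: residue_regular_def H2_ext_def H2_rhp_def)
  have "?g field_differentiable at s" if "s \<noteq> psi_inv \<psi> X \<mu>" for s
  proof (cases "0 < Re s")
    case True
    then show ?thesis
      using g(1) open_halfspace_Re_gt[of 0] by (auto intro: holomorphic_on_imp_differentiable_at)
  next
    case False
    then show ?thesis
      using g(2) that by (auto intro: analytic_on_imp_differentiable_at)
  qed
  then show ?thesis
    by (auto simp: holomorphic_on_def intro: field_differentiable_at_within)
qed

lemma kernel_eq:
  "\<not> is_pole \<psi> s \<Longrightarrow> hfrak \<psi> q (\<lambda>s. 1 / (s - \<mu>)) s = q s / (\<psi> s - \<mu>)"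
  by (simp add: hfrak_def)

lemma kernel_square:
  assumes "\<not> is_pole \<psi> s"
  shows "hfrak \<psi> q (\<lambda>s. 1 / (s - \<mu>)) s ^ 2 = deriv \<psi> s / (\<psi> s - \<mu>) ^ 2"
  using root assms by (simp add: kernel_eq power_divide sqrt_deriv_def)

text \<open>If \<open>\<psi>\<close> took the value \<open>\<mu>\<close> at a second point, the reciprocal of \<open>\<psi> - \<mu>\<close> would be unbounded
  there although its derivative is minus the square of the transformed kernel, hence bounded.\<close>

lemma unique_preimage:
  assumes "\<mu> \<in> A" and z: "\<not> is_pole \<psi> z" "\<psi> z = \<mu>"
  shows "z = psi_inv \<psi> X \<mu>"
proof (rule ccontr)
  define p where "p = psi_inv \<psi> X \<mu>"
  define g where "g = hfrak \<psi> q (\<lambda>s. 1 / (s - \<mu>))"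
  assume "z \<noteq> psi_inv \<psi> X \<mu>"
  then have zp: "z \<noteq> p" by (simp add: p_def)
  have p: "p \<in> X" "\<psi> p = \<mu>" using psi_inv_facts[OF setting assms(1)] by (auto simp: p_def)
  have g: "g holomorphic_on - {p}"
    using kernel_holomorphic[OF assms(1)] by (simp add: g_def p_def)
  obtain S where S: "open S" "z \<in> S" "\<psi> holomorphic_on S"
    using analytic_at_nonpole[OF z(1)] by (auto simp: analytic_at)
  then obtain r where r: "r > 0" "ball z r \<subseteq> S - {p}"
    using zp openE[of "S - {p}" z] by auto
  then have hol: "\<psi> holomorphic_on ball z r" and pr: "p \<notin> ball z r"
    using S(3) by (auto intro: holomorphic_on_subset)
  have np: "\<not> is_pole \<psi> s" if "s \<in> ball z r" for s
    using hol that analytic_on_open[OF open_ball, of \<psi> z r] analytic_on_analytic_at[of \<psi>]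
      analytic_at_imp_no_pole by blast
  \<comment> \<open>If \<open>\<psi>\<close> were constant near z, the kernel would vanish there
    and, by the identity theorem, everywhere off p; but it is nonzero in X close to p.\<close>
  obtain s0 where s0: "s0 \<in> ball z r" "\<psi> s0 \<noteq> \<mu>"
  proof (rule ccontr)
    assume "\<not> thesis"
    with that have "\<psi> s = \<mu>" if "s \<in> ball z r" for s using \<open>s \<in> ball z r\<close> by blast
    \<comment> \<open>Here the kernel is \<open>q s / 0\<close>, which is 0 by convention.\<close>
    then have "g s = 0" if "s \<in> ball z r" for s
      using that np by (simp add: g_def kernel_eq)
    moreover have "connected (- {p})" "open (- {p})"
      using connected_punctured_universe[of p] by auto
    ultimately have g0: "g s = 0" if "s \<noteq> p" for s
      using analytic_continuation_open[of "ball z r" "- {p}" g "\<lambda>_. 0" s] r g that pr by auto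
    obtain e where e: "e > 0" "ball p e \<subseteq> X"
      using settingD(2) p(1) openE by blast
    define s where "s = p + of_real (e / 2)"
    have s: "s \<in> X" "s \<noteq> p" using e by (auto simp: s_def dist_norm intro!: subsetD[OF e(2)])
    then have "\<psi> s \<noteq> \<mu>" using settingD(6) p by (auto dest: inj_onD)
    then show False
      using g0[OF s(2)] q_nonzero[OF s(1)] nonpole_X[OF s(1)] by (simp add: g_def kernel_eq)
  qed
  obtain r' where r': "0 < r'" "ball z r' \<subseteq> ball z r" "\<And>s. s \<in> ball z r' - {z} \<Longrightarrow> \<psi> s - \<mu> \<noteq> 0"
  proof (rule isolated_zeros[of "\<lambda>s. \<psi> s - \<mu>" "ball z r" z s0])
    show "(\<lambda>s. \<psi> s - \<mu>) holomorphic_on ball z r" using hol by (intro holomorphic_intros)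
  qed (use r z s0 that in auto)
  have "(\<lambda>s. - (g s ^ 2)) holomorphic_on ball z r'"
    using g pr r'(2) by (intro holomorphic_intros) (auto elim!: holomorphic_on_subset)
  \<comment> \<open>Y is holomorphic at z as well and has the same derivative as the reciprocal of
    \<open>\<psi> - \<mu>\<close> in the punctured ball.\<close>
  then obtain Y where Y: "\<And>s. s \<in> ball z r' \<Longrightarrow> (Y has_field_derivative - (g s ^ 2)) (at s)"
    using holomorphic_convex_primitive'[of "ball z r'"] by (metis convex_ball open_ball at_within_open)
  have "((\<lambda>s. inverse (\<psi> s - \<mu>) - Y s) has_field_derivative 0) (at s)" if "s \<in> ball z r' - {z}" for s
  proof -
    have s: "s \<in> ball z r'" "s \<in> ball z r" using that r'(2) by auto
    have "(\<psi> has_field_derivative deriv \<psi> s) (at s)"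
      using hol s(2) by (intro holomorphic_derivI[OF _ open_ball])
    then show ?thesis
      using r'(3)[OF that] Y[OF s(1)] kernel_square[OF np[OF s(2)], of \<mu>]
      by (auto intro!: derivative_eq_intros simp: g_def field_simps power2_eq_square)
  qed
  moreover have "connected (ball z r' - {z})" "open (ball z r' - {z})"
    by (auto intro: connected_open_delete)
  ultimately obtain c where c: "\<And>s. s \<in> ball z r' - {z} \<Longrightarrow> inverse (\<psi> s - \<mu>) - Y s = c"
    using has_field_derivative_0_imp_constant_on[of "ball z r' - {z}" "\<lambda>s. inverse (\<psi> s - \<mu>) - Y s"]
    unfolding constant_on_def by blast
  have ev: "eventually (\<lambda>s. s \<in> ball z r' - {z}) (at z)"
    using r'(1) by (intro eventually_at_in_open) auto
  have "isCont \<psi> z" "isCont Y z"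
    using analytic_at_nonpole[OF z(1)] analytic_at_imp_isCont Y[of z] r'(1) DERIV_isCont by auto
  \<comment> \<open>The product is 1 off z, while its limit at z is 0.\<close>
  then have "((\<lambda>s. (\<psi> s - \<mu>) * (Y s + c)) \<longlongrightarrow> (\<psi> z - \<mu>) * (Y z + c)) (at z)"
    by (intro tendsto_intros) (auto simp: isCont_def)
  moreover have "eventually (\<lambda>s. (\<psi> s - \<mu>) * (Y s + c) = 1) (at z)"
    using ev
  proof eventually_elim
    case (elim s)
    have "Y s + c = inverse (\<psi> s - \<mu>)" using c[OF elim] by (simp add: algebra_simps)
    then show ?case using r'(3)[OF elim] by simp
  qed
  ultimately have "(\<psi> z - \<mu>) * (Y z + c) = 1"
    using tendsto_unique[OF trivial_limit_at _ tendsto_eventually] by blast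
  then show False using z(2) by simp
qed

text \<open>If \<open>\<psi> s = \<psi> p + (s - p) / l s\<close> with l affine, then this recovers
  l. The special cases fill in the removable singularities at p and at the poles of
  \<open>\<psi>\<close>.\<close>

definition linear_factor :: "complex \<Rightarrow> complex \<Rightarrow> complex" where
  "linear_factor p s = (if s = p then inverse (deriv \<psi> p) else if is_pole \<psi> s then 0 else (s - p) / (\<psi> s - \<psi> p))"

text \<open>By \<open>unique_preimage\<close> the denominator vanishes only at p, to first order
  since \<open>\<psi>\<close> is conformal on X; poles of \<open>\<psi>\<close> become zeros.
  Continuity at these isolated points makes them removable.\<close>

lemma linear_factor_holomorphic:
  assumes p: "p \<in> X"
  shows "linear_factor p holomorphic_on UNIV"
proof -
  let ?V = "linear_factor p"
  have psip: "\<psi> p \<in> A" "psi_inv \<psi> X (\<psi> p) = p"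
    using settingD(6,7) p by auto
  have diff: "?V field_differentiable at a" if a: "\<not> is_pole \<psi> a" "a \<noteq> p" for a
  proof -
    obtain S where S: "open S" "a \<in> S" "\<psi> analytic_on S"
      using analytic_at_nonpole[OF a(1)] by (metis analytic_at analytic_on_open)
    have "?V s = (s - p) / (\<psi> s - \<psi> p)" if "s \<in> S - {p}" for s
      using that S(3) analytic_on_analytic_at[of \<psi> S] analytic_at_imp_no_pole by (auto simp: linear_factor_def)
    moreover have "\<psi> a \<noteq> \<psi> p"
      using unique_preimage[OF psip(1) a(1)] a(2) psip(2) by auto
    then have "(\<lambda>s. (s - p) / (\<psi> s - \<psi> p)) field_differentiable at a"
      using analytic_at_nonpole[OF a(1)]
      by (intro field_differentiable_divide field_differentiable_diff)
         (auto intro: analytic_on_imp_differentiable_at)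
    moreover have "open (S - {p})" "a \<in> S - {p}" using S a by auto
    ultimately show ?thesis
      unfolding field_differentiable_def
      using has_field_derivative_transform_within_open[of "\<lambda>s. (s - p) / (\<psi> s - \<psi> p)" _ a "S - {p}" ?V] by metis
  qed
  have cont: "isCont ?V a" for a
  proof (cases "a = p")
    case True
    have "(\<psi> has_field_derivative deriv \<psi> p) (at p)"
      using analytic_on_imp_differentiable_at[OF settingD(4)[OF p]] by (simp add: field_differentiable_derivI)
    then have "((\<lambda>s. (\<psi> s - \<psi> p) / (s - p)) \<longlongrightarrow> deriv \<psi> p) (at p)"
      by (simp only: has_field_derivative_iff)
    from tendsto_inverse[OF this settingD(5)[OF p]]
    have lim: "((\<lambda>s. (s - p) / (\<psi> s - \<psi> p)) \<longlongrightarrow> inverse (deriv \<psi> p)) (at p)"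
      by (simp add: inverse_divide)
    have "eventually (\<lambda>s. ?V s = (s - p) / (\<psi> s - \<psi> p)) (at p)"
      using eventually_nonpole eventually_neq_at_within[of p p UNIV]
      by eventually_elim (simp add: linear_factor_def)
    then have "(?V \<longlongrightarrow> inverse (deriv \<psi> p)) (at p)"
      by (rule iffD2[OF tendsto_cong lim])
    moreover have "?V p = inverse (deriv \<psi> p)" by (simp add: linear_factor_def)
    ultimately show ?thesis
      using True by (simp add: isCont_def)
  next
    case False
    show ?thesis
    proof (cases "is_pole \<psi> a")
      case True
      have "filterlim (\<lambda>s. \<psi> s - \<psi> p) at_infinity (at a)"
        using True tendsto_add_filterlim_at_infinity'[OF _ tendsto_const, of \<psi> "at a" "- \<psi> p"]
        by (simp add: is_pole_def)
      then have lim: "((\<lambda>s. (s - p) / (\<psi> s - \<psi> p)) \<longlongrightarrow> 0) (at a)"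
        by (intro tendsto_divide_0[of _ "a - p"] tendsto_intros)
      have "eventually (\<lambda>s. ?V s = (s - p) / (\<psi> s - \<psi> p)) (at a)"
        using eventually_nonpole eventually_neq_at_within[of p a UNIV]
        by eventually_elim (simp add: linear_factor_def)
      then have "(?V \<longlongrightarrow> 0) (at a)"
        by (rule iffD2[OF tendsto_cong lim])
      moreover have "?V a = 0" using True False by (simp add: linear_factor_def)
      ultimately show ?thesis
        by (simp add: isCont_def)
    next
      case nonpole: False
      show ?thesis
        using diff[OF nonpole False] field_differentiable_imp_continuous_at by blast
    qed
  qed
  have "?V field_differentiable at a" for a
  proof -
    have "eventually (\<lambda>s. \<not> is_pole \<psi> s \<and> s \<noteq> p) (at a)"
      using eventually_nonpole eventually_neq_at_within by (rule eventually_conj)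
    then obtain e where e: "e > 0" "\<And>s. s \<noteq> a \<Longrightarrow> dist s a < e \<Longrightarrow> \<not> is_pole \<psi> s \<and> s \<noteq> p"
      by (auto simp: eventually_at)
    have "?V holomorphic_on ball a e"
    proof (rule no_isolated_singularity)
      show "?V holomorphic_on ball a e - {a}"
        unfolding holomorphic_on_def
      proof
        fix s assume "s \<in> ball a e - {a}"
        then have "s \<noteq> a" "dist s a < e" by (auto simp: dist_commute)
        note e(2)[OF this]
        then have "?V field_differentiable at s" using diff by blast
        then show "?V field_differentiable at s within ball a e - {a}"
          by (rule field_differentiable_at_within)
      qed
      show "continuous_on (ball a e) ?V"
        by (rule continuous_at_imp_continuous_on) (simp add: cont)
    qed simp_all
    then show ?thesis
      using holomorphic_on_imp_differentiable_at[of ?V "ball a e" a] e(1) by simp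
  qed
  then show ?thesis unfolding holomorphic_on_def by simp
qed

text \<open>A ball about p covers a disc about \<open>\<psi> p\<close> by the open mapping theorem.
  As values in A are taken only once, \<open>\<psi>\<close> stays outside that disc when s is
  outside the ball, which bounds the denominator from below.\<close>

lemma linear_factor_growth:
  assumes p: "p \<in> X"
  shows "\<exists>a B. \<forall>s. a \<le> cmod s \<longrightarrow> cmod (linear_factor p s) \<le> B * cmod s"
proof -
  obtain \<rho> where \<rho>: "\<rho> > 0" "ball p \<rho> \<subseteq> X"
    using settingD(2) p openE by blast
  have "\<psi> holomorphic_on ball p \<rho>"
    using settingD(4) \<rho>(2) analytic_imp_holomorphic analytic_on_analytic_at by blast
  then have "open (\<psi> ` ball p \<rho>)"
    using inj_on_subset[OF settingD(6) \<rho>(2)] by (intro open_mapping_thm3) auto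
  then obtain \<delta> where \<delta>: "\<delta> > 0" "ball (\<psi> p) \<delta> \<subseteq> \<psi> ` ball p \<rho>"
    using \<rho>(1) openE[of "\<psi> ` ball p \<rho>" "\<psi> p"] by auto
  have far: "\<delta> \<le> cmod (\<psi> s - \<psi> p)" if s: "\<not> is_pole \<psi> s" "s \<notin> ball p \<rho>" for s
  proof (rule ccontr)
    assume "\<not> ?thesis"
    then have "\<psi> s \<in> ball (\<psi> p) \<delta>" by (simp add: mem_ball dist_norm norm_minus_commute)
    then have "\<psi> s \<in> \<psi> ` ball p \<rho>" using \<delta>(2) by (rule subsetD[rotated])
    then obtain t where t: "t \<in> ball p \<rho>" "\<psi> s = \<psi> t" by auto
    then have "\<psi> t \<in> A" "t \<in> X" using \<rho>(2) settingD(7) by auto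
    then have "s = t"
      using unique_preimage[of "\<psi> t" s] s(1) t(2) settingD(6) by simp
    then show False using t(1) s(2) by simp
  qed
  have "cmod (linear_factor p s) \<le> 2 / \<delta> * cmod s" if s: "cmod p + \<rho> \<le> cmod s" for s
  proof -
    have d: "\<rho> \<le> cmod (s - p)" "cmod (s - p) \<le> 2 * cmod s"
    proof -
      show "\<rho> \<le> cmod (s - p)" using s norm_triangle_ineq2[of s p] by linarith
      show "cmod (s - p) \<le> 2 * cmod s" using s \<rho>(1) norm_triangle_ineq4[of s p] by linarith
    qed
    have "dist p s = cmod (s - p)" by (simp only: dist_norm norm_minus_commute)
    with d(1) \<rho>(1) have s': "s \<notin> ball p \<rho>" "s \<noteq> p" by auto
    show ?thesis
    proof (cases "is_pole \<psi> s")
      case True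
      then show ?thesis using s'(2) \<delta>(1) by (simp add: linear_factor_def)
    next
      case False
      have "cmod (s - p) / cmod (\<psi> s - \<psi> p) \<le> 2 * cmod s / \<delta>"
        by (rule frac_le[OF _ d(2) \<delta>(1) far[OF False s'(1)]]) simp
      then show ?thesis using False s'(2) by (simp add: linear_factor_def norm_divide)
    qed
  qed
  then show ?thesis by blast
qed

lemma linear_factor_eq:
  assumes p: "p \<in> X"
  shows "\<exists>c. \<forall>s. linear_factor p s = inverse (deriv \<psi> p) + c * (s - p)"
proof -
  obtain a B where "\<And>s. a \<le> cmod s \<Longrightarrow> cmod (linear_factor p s) \<le> B * cmod s"
    using linear_factor_growth[OF p] by blast
  then have aB: "cmod (linear_factor p s) \<le> B * cmod s ^ 1" if "a \<le> cmod s" for s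
    using that by simp
  have L: "linear_factor p s = (\<Sum>k\<le>1. (deriv ^^ k) (linear_factor p) 0 / fact k * s ^ k)" for s
    using linear_factor_holomorphic[OF p] aB by (rule Liouville_polynomial)
  have L1: "linear_factor p s = linear_factor p 0 + deriv (linear_factor p) 0 * s" for s
    by (rule L[THEN trans]) simp
  have "linear_factor p s = linear_factor p p + deriv (linear_factor p) 0 * (s - p)" for s
    using L1[of s] L1[of p] by (simp add: algebra_simps)
  moreover have "linear_factor p p = inverse (deriv \<psi> p)"
    by (simp add: linear_factor_def)
  ultimately show ?thesis by auto
qed

end

text \<open>The last assumption carries the reduction to the half plane: elementary fractions in
  \<open>\<psi>\<close> with poles \<open>\<psi> t\<close> turn into elementary fractions with poles
  t, up to the factor \<open>poly L t / \<kappa>\<close>.\<close>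

locale moebius_setting = regular_setting +
  fixes L N :: "complex poly" and \<kappa> :: complex
  assumes L: "L \<noteq> 0" and \<kappa>: "\<kappa> \<noteq> 0" and pole_iff: "is_pole \<psi> s \<longleftrightarrow> poly L s = 0"
    and psi_eq: "\<not> is_pole \<psi> s \<Longrightarrow> \<psi> s = poly N s / poly L s"
    and q_eq: "\<not> is_pole \<psi> s \<Longrightarrow> q s = \<kappa> / poly L s"
    and kernel_psi: "\<not> is_pole \<psi> s \<Longrightarrow> \<not> is_pole \<psi> t \<Longrightarrow> q s / (\<psi> s - \<psi> t) = poly L t / \<kappa> / (s - t)"

lemma (in regular_setting) moebius_form:
  assumes p: "p \<in> X"
  shows "\<exists>L N \<kappa>. moebius_setting \<psi> q X A L N \<kappa>"
proof -
  have psip: "\<psi> p \<in> A" "psi_inv \<psi> X (\<psi> p) = p"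
    using settingD(6,7) p by auto
  define d where "d = inverse (deriv \<psi> p)"
  have d: "d \<noteq> 0" using settingD(5)[OF p] by (simp add: d_def)
  obtain c where c: "\<And>s. linear_factor p s = d + c * (s - p)"
    unfolding d_def using linear_factor_eq[OF p] by blast
  define L where "L = [:d - c * p, c:]"
  have L: "linear_factor p s = poly L s" "poly L s = d + c * (s - p)" for s
    by (simp_all add: c L_def algebra_simps)
  have pole: "is_pole \<psi> s \<longleftrightarrow> poly L s = 0" for s
  proof (cases "s = p")
    case True
    then show ?thesis using nonpole_X[OF p] d by (simp add: L(2))
  next
    case False
    have "\<psi> s \<noteq> \<psi> p" if "\<not> is_pole \<psi> s"
      using unique_preimage[OF psip(1) that] False psip(2) by auto
    then show ?thesis using False unfolding L(1)[symmetric] linear_factor_def by auto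
  qed
  have psi: "\<psi> s = \<psi> p + (s - p) / poly L s" if "\<not> is_pole \<psi> s" for s
  proof (cases "s = p")
    case False
    then have "poly L s = (s - p) / (\<psi> s - \<psi> p)"
      using that unfolding L(1)[symmetric] linear_factor_def by simp
    then show ?thesis using that pole[of s] by auto
  qed simp
  have dpsi: "deriv \<psi> s = d / poly L s ^ 2" if s: "\<not> is_pole \<psi> s" for s
  proof -
    have nz: "poly L s \<noteq> 0" using s pole by simp
    have "((\<lambda>t. \<psi> p + (t - p) / (d + c * (t - p))) has_field_derivative d / poly L s ^ 2) (at s)"
      using nz unfolding L(2) by (auto intro!: derivative_eq_intros simp: power2_eq_square)
    moreover have "open {t. poly L t \<noteq> 0}"
      by (intro open_Collect_neq continuous_intros)
    ultimately have "(\<psi> has_field_derivative d / poly L s ^ 2) (at s)"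
      by (rule has_field_derivative_transform_within_open) (use nz pole psi in \<open>simp_all add: L(2)\<close>)
    then show ?thesis by (rule DERIV_imp_deriv)
  qed
  \<comment> \<open>S is \<open>q * L\<close>, continued across the poles of \<open>\<psi>\<close>.
    It is continuous on a connected set and its square is the constant d, so it is constant; this
    fixes the sign of the root globally.\<close>
  define S where "S s = hfrak \<psi> q (\<lambda>s. 1 / (s - \<psi> p)) s * (s - p)" for s
  have S: "S s = q s * poly L s" if "\<not> is_pole \<psi> s" "s \<noteq> p" for s
    using that psi[OF that(1)] pole[of s] by (simp add: S_def kernel_eq)
  have sq: "(q s * poly L s) ^ 2 = d" if "\<not> is_pole \<psi> s" for s
    using that root dpsi[OF that] pole[of s] by (simp add: sqrt_deriv_def power_mult_distrib)
  have "S holomorphic_on - {p}"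
    unfolding S_def using kernel_holomorphic[OF psip(1)] psip(2) by (intro holomorphic_intros) simp
  then have cont: "continuous_on (- {p}) S" by (rule holomorphic_on_imp_continuous_on)
  have S2: "S s ^ 2 = d" if s: "s \<noteq> p" for s
  proof -
    have "isCont S s" using cont s continuous_on_eq_continuous_at[of "- {p}" S] by auto
    then have "((\<lambda>t. S t ^ 2) \<longlongrightarrow> S s ^ 2) (at s)" unfolding isCont_def by (rule tendsto_power)
    moreover have "eventually (\<lambda>t. S t ^ 2 = d) (at s)"
      using eventually_nonpole eventually_neq_at_within[of p s UNIV]
      by eventually_elim (simp add: S sq)
    ultimately show ?thesis
      by (rule tendsto_unique[OF trivial_limit_at _ tendsto_eventually])
  qed
  have "S ` (- {p}) \<subseteq> {csqrt d, - csqrt d}"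
  proof (rule image_subsetI)
    fix s assume "s \<in> - {p}"
    then have "S s ^ 2 = csqrt d ^ 2" using S2 by simp
    then show "S s \<in> {csqrt d, - csqrt d}" unfolding power2_eq_iff by simp
  qed
  then have "finite (S ` (- {p}))" by (rule finite_subset) simp
  moreover have "connected (- {p})" by (rule connected_punctured_universe) simp
  ultimately have "S constant_on - {p}"
    using cont by (intro continuous_finite_range_constant)
  then obtain \<kappa> where \<kappa>: "\<And>s. s \<noteq> p \<Longrightarrow> S s = \<kappa>" by (auto simp: constant_on_def)
  \<comment> \<open>Only the point p is left, and there \<open>q\<close> is continuous because it is
    analytic on X.\<close>
  have "((\<lambda>t. q t * poly L t) \<longlongrightarrow> q p * poly L p) (at p)"
    using analytic_at_imp_isCont[of q p] q_analytic p analytic_on_analytic_at[of q X]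
    by (intro tendsto_intros) (auto simp: isCont_def poly_isCont[unfolded isCont_def])
  moreover have "eventually (\<lambda>t. q t * poly L t = \<kappa>) (at p)"
    using eventually_nonpole eventually_neq_at_within[of p p UNIV]
    by eventually_elim (use S \<kappa> in metis)
  ultimately have "q p * poly L p = \<kappa>"
    by (rule tendsto_unique[OF trivial_limit_at _ tendsto_eventually])
  then have q: "q s * poly L s = \<kappa>" if "\<not> is_pole \<psi> s" for s
    using S[OF that] \<kappa>[of s] by (cases "s = p") auto
  have \<kappa>2: "\<kappa> ^ 2 = d" using sq[OF nonpole_X[OF p]] q[OF nonpole_X[OF p]] by simp
  then have \<kappa>0: "\<kappa> \<noteq> 0" using d by auto
  have L0: "L \<noteq> 0" using pole[of p] nonpole_X[OF p] by auto
  have "moebius_setting \<psi> q X A L (smult (\<psi> p) L + [:- p, 1:]) \<kappa>"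
  proof (intro moebius_setting.intro moebius_setting_axioms.intro regular_setting_axioms L0 \<kappa>0 pole)
    fix s assume s: "\<not> is_pole \<psi> s"
    show "\<psi> s = poly (smult (\<psi> p) L + [:- p, 1:]) s / poly L s"
      using psi[OF s] pole[of s] s by (simp add: add_divide_distrib)
    show qs: "q s = \<kappa> / poly L s"
      using q[OF s] pole[of s] s by (simp add: field_simps)
    fix t assume t: "\<not> is_pole \<psi> t"
    have nz: "poly L s \<noteq> 0" "poly L t \<noteq> 0" using pole s t by auto
    have "\<psi> s - \<psi> t = ((s - p) * poly L t - (t - p) * poly L s) / (poly L s * poly L t)"
      unfolding psi[OF s] psi[OF t] using nz by (simp add: field_simps)
    also have "(s - p) * poly L t - (t - p) * poly L s = d * (s - t)"
      unfolding L(2) by (simp add: algebra_simps)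
    also have "d = \<kappa> ^ 2" by (rule \<kappa>2[symmetric])
    finally show "q s / (\<psi> s - \<psi> t) = poly L t / \<kappa> / (s - t)"
      unfolding qs using nz \<kappa>0 by (simp add: power2_eq_square)
  qed
  then show ?thesis by blast
qed

section \<open>Stationarity of local minimizers\<close>

text \<open>Approaching 0 along positive multiples of \<open>cnj D\<close>, the real part of f grows
  like \<open>cmod D ^ 2\<close> times the parameter, which a quadratic bound permits only for D =
  0.\<close>

lemma derivative_zero_if_Re_le_square:
  fixes f :: "complex \<Rightarrow> complex"
  assumes f: "(f has_field_derivative D) (at 0)" "f 0 = 0"
    and ev: "eventually (\<lambda>t. Re (f t) \<le> K * cmod t ^ 2) (nhds 0)"
  shows "D = 0"
proof -
  define u where "u = cnj D"
  have "((\<lambda>t. f (t * u)) has_field_derivative D * u) (at 0)"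
    using f(1) by (intro DERIV_chain2[of f]) (auto intro!: derivative_eq_intros)
  then have "((\<lambda>t. f (t * u) / t) \<longlongrightarrow> D * u) (at 0)"
    by (simp add: has_field_derivative_iff f(2))
  moreover have ofr: "filterlim complex_of_real (at 0) (at_right 0)"
    by (intro filterlim_atI tendsto_eq_intros) (auto simp: eventually_at_right_less eventually_at_filter)
  ultimately have "((\<lambda>x. f (of_real x * u) / of_real x) \<longlongrightarrow> D * u) (at_right 0)"
    by (rule filterlim_compose)
  then have lim: "((\<lambda>x. Re (f (of_real x * u) / of_real x)) \<longlongrightarrow> Re (D * u)) (at_right 0)"
    by (rule tendsto_Re)
  have "((\<lambda>x. complex_of_real x * u) \<longlongrightarrow> 0) (at_right 0)"
    by (auto intro!: tendsto_eq_intros)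
  with ev have "eventually (\<lambda>x. Re (f (of_real x * u)) \<le> K * cmod (of_real x * u) ^ 2) (at_right 0)"
    by (rule eventually_compose_filterlim)
  then have "eventually (\<lambda>x. Re (f (of_real x * u) / of_real x) \<le> K * cmod u ^ 2 * x) (at_right 0)"
    using eventually_at_right_less[of 0]
    by eventually_elim (simp add: Re_divide_of_real norm_mult power_mult_distrib pos_divide_le_eq power2_eq_square mult_ac)
  moreover have "((\<lambda>x. K * cmod u ^ 2 * x) \<longlongrightarrow> 0) (at_right 0)"
    by (auto intro!: tendsto_eq_intros)
  ultimately have le: "Re (D * u) \<le> 0"
    using lim by (intro tendsto_le[of "at_right (0::real)"]) auto
  have eq: "Re (D * u) = cmod D ^ 2"
    unfolding u_def cmod_power2 by (simp add: power2_eq_square)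
  show ?thesis using le unfolding eq by simp
qed

lemma transfer_fun_diagonal:
  fixes l \<phi> :: "'k::finite \<Rightarrow> complex"
  assumes s: "s \<notin> range l"
  shows "transfer_fun (\<chi> i j. if i = j then l i else 0) (\<chi> i. \<phi> i) (\<chi> i. 1) s = (\<Sum>i\<in>UNIV. \<phi> i / (s - l i))"
proof -
  let ?M = "(\<chi> i j. if i = j then l i else 0) :: complex^'k^'k"
  let ?b = "(\<chi> i. \<phi> i) :: complex^'k"
  have inv: "(matrix_inv (mat t - ?M) *v ?b) $ i = \<phi> i / (t - l i)" if t: "t \<notin> range l" for t i
  proof -
    have nz: "t - l i \<noteq> 0" for i using t by auto
    let ?N = "(\<chi> i j. if i = j then 1 / (t - l i) else 0) :: complex^'k^'k"
    have M: "mat t - ?M = (\<chi> i j. if i = j then t - l i else 0)"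
      by (simp add: vec_eq_iff mat_def)
    have "(mat t - ?M) ** ?N = mat 1"
      unfolding M using nz by (simp add: vec_eq_iff matrix_matrix_mult_def mat_def mult_delta_left)
    then have "invertible (mat t - ?M)" by (auto simp: invertible_right_inverse)
    then have "(mat t - ?M) *v (matrix_inv (mat t - ?M) *v ?b) = ?b"
      by (simp add: matrix_vector_mul_assoc matrix_inv_right_inverse)
    then have "((mat t - ?M) *v (matrix_inv (mat t - ?M) *v ?b)) $ i = \<phi> i" by simp
    moreover have "((mat t - ?M) *v x) $ i = (t - l i) * x $ i" for x
      unfolding M by (simp add: matrix_vector_mult_def mult_delta_left)
    ultimately show ?thesis using nz by (simp add: field_simps)
  qed
  define f where "f t = (\<Sum>i\<in>UNIV. cnj (((\<chi> i. 1) :: complex^'k) $ i) * (matrix_inv (mat t - ?M) *v ?b) $ i)" for t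
  have f: "f t = (\<Sum>i\<in>UNIV. \<phi> i / (t - l i))" if "t \<notin> range l" for t
    using inv[OF that] by (simp add: f_def)
  have "open (- range l)" by (intro open_Compl finite_imp_closed) simp
  moreover have "(\<lambda>t. \<Sum>i\<in>UNIV. \<phi> i / (t - l i)) holomorphic_on - range l"
    by (intro holomorphic_intros) auto
  then have "f holomorphic_on - range l"
    by (subst holomorphic_cong[OF refl f]) simp_all
  ultimately have "f analytic_on {s}"
    using s analytic_on_open analytic_on_subset[of f "- range l" "{s}"] by auto
  then show ?thesis
    unfolding transfer_fun_def f_def[symmetric, abs_def] using f[OF s] by simp
qed

text \<open>The increment of a reduced transform when the fraction with residue b and pole p' is
  exchanged for the one with residue a and pole p.\<close>

definition pole_difference :: "complex \<Rightarrow> complex \<Rightarrow> complex \<Rightarrow> complex \<Rightarrow> complex \<Rightarrow> complex" where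
  "pole_difference a p b p' = (\<lambda>s. a * (1 / (s - p)) - b * (1 / (s - p')))"

context moebius_setting
begin

lemma finite_poles: "finite {s. is_pole \<psi> s}"
  using poly_roots_finite[OF L] by (simp add: pole_iff)

lemma psi_notin_A:
  assumes "0 \<le> Re s" "\<not> is_pole \<psi> s"
  shows "\<psi> s \<notin> A"
  using unique_preimage[OF _ assms(2) refl] psi_inv_facts(1)[OF setting] settingD(3) assms(1)
  by fastforce

lemma hfrak_partial_fractions:
  fixes p \<phi> :: "'k::finite \<Rightarrow> complex"
  assumes p: "\<And>i. p i \<in> X" and F: "\<And>s. s \<notin> A \<Longrightarrow> F s = (\<Sum>i\<in>UNIV. \<phi> i / (s - \<psi> (p i)))"
    and s: "0 < Re s"
  shows "hfrak \<psi> q F s = (\<Sum>i\<in>UNIV. \<phi> i * (poly L (p i) / \<kappa>) * (1 / (s - p i)))"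
proof -
  define R where "R s = (\<Sum>i\<in>UNIV. \<phi> i * (poly L (p i) / \<kappa>) * (1 / (s - p i)))" for s
  have nonpole: "F (\<psi> t) * q t = R t" if t: "0 < Re t" "\<not> is_pole \<psi> t" for t
  proof -
    have "F (\<psi> t) * q t = (\<Sum>i\<in>UNIV. \<phi> i * (q t / (\<psi> t - \<psi> (p i))))"
      using F[OF psi_notin_A] t by (simp add: sum_distrib_right)
    also have "\<dots> = R t"
      unfolding R_def kernel_psi[OF t(2) nonpole_X[OF p]] by (simp add: mult.assoc)
    finally show ?thesis .
  qed
  have "hfrak \<psi> q F s = R s"
  proof (cases "is_pole \<psi> s")
    case True
    \<comment> \<open>At a pole of \<open>\<psi>\<close> the transform is defined as a limit, which
      continuity of the partial fractions evaluates.\<close>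
    have "s - p i \<noteq> 0" for i using settingD(3)[OF p, of i] s by auto
    then have "(R \<longlongrightarrow> R s) (at s)"
      unfolding R_def by (intro tendsto_intros) auto
    moreover have "eventually (\<lambda>t. t \<in> {t. 0 < Re t}) (at s)"
      using s by (intro eventually_at_in_open' open_halfspace_Re_gt) simp
    with eventually_nonpole have "eventually (\<lambda>t. R t = F (\<psi> t) * q t) (at s)"
      by eventually_elim (simp add: nonpole)
    ultimately have "((\<lambda>t. F (\<psi> t) * q t) \<longlongrightarrow> R s) (at s)"
      by (rule Lim_transform_eventually)
    then show ?thesis using True by (simp add: hfrak_def tendsto_Lim)
  qed (use nonpole s in \<open>simp add: hfrak_def\<close>)
  then show ?thesis by (simp add: R_def)
qed

lemma hfrak_rational:
  assumes F: "F \<in> H2_ext \<psi> q A" "rational_fun F"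
  obtains R where "rhp_regular R" "\<And>s. 0 < Re s \<Longrightarrow> hfrak \<psi> q F s = R s"
proof -
  obtain P Q E where PQ: "finite E" "\<And>s. s \<notin> E \<Longrightarrow> F s = poly P s / poly Q s"
    using rational_funE[OF F(2)] by metis
  define f where "f s = poly P (poly N s / poly L s) / poly Q (poly N s / poly L s) * (\<kappa> / poly L s)" for s
  have "rational_fun f"
    unfolding f_def
    by (intro rational_fun_mult rational_fun_divide rational_fun_poly_comp rational_fun_poly rational_fun_const)
  then obtain P' Q' E' where f: "Q' \<noteq> 0" "finite E'" "\<And>s. s \<notin> E' \<Longrightarrow> f s = poly P' s / poly Q' s"
    using rational_funE by metis
  have "inj_on \<psi> {s. \<not> is_pole \<psi> s}"
  proof (rule inj_onI)
    fix s t assume st: "s \<in> {s. \<not> is_pole \<psi> s}" "t \<in> {s. \<not> is_pole \<psi> s}" "\<psi> s = \<psi> t"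
    \<comment> \<open>The left side of \<open>kernel_psi\<close> is a division by zero, hence 0; the
      numerator on the right being nonzero, \<open>s - t\<close> is 0. Injectivity makes the
      preimage of the exceptional set of F finite.\<close>
    then have "poly L t / \<kappa> / (s - t) = 0" using kernel_psi[of s t] by simp
    then show "s = t" using st \<kappa> pole_iff by simp
  qed
  then have fin: "finite (\<psi> -` E \<inter> {s. \<not> is_pole \<psi> s})"
    by (rule finite_vimage_IntI[OF PQ(1)])
  define B where "B = (\<psi> -` E \<inter> {s. \<not> is_pole \<psi> s}) \<union> {s. is_pole \<psi> s} \<union> E'"
  have "hfrak \<psi> q F s = poly P' s / poly Q' s" if "s \<notin> B" for s
  proof -
    have "\<psi> s \<notin> E" "\<not> is_pole \<psi> s" "s \<notin> E'" using that by (auto simp: B_def)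
    then show ?thesis using PQ(2) f(3)[of s] by (simp add: hfrak_def f_def psi_eq q_eq)
  qed
  then have "{s. 0 < Re s \<and> hfrak \<psi> q F s \<noteq> poly P' s / poly Q' s} \<subseteq> B"
    by auto
  moreover have "finite B" unfolding B_def using fin finite_poles f(2) by blast
  ultimately have fin': "finite {s. 0 < Re s \<and> hfrak \<psi> q F s \<noteq> poly P' s / poly Q' s}"
    by (rule finite_subset)
  have "hfrak \<psi> q F \<in> H2_rhp" using F(1) by (simp add: H2_ext_def)
  from H2_rhp_rational[OF this f(1) fin'] show ?thesis using that by blast
qed

lemma norm_diff_eq:
  assumes F: "\<And>s. 0 < Re s \<Longrightarrow> hfrak \<psi> q F s = R s" and G: "\<And>s. 0 < Re s \<Longrightarrow> hfrak \<psi> q G s = S s"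
    and RS: "rhp_regular R" "rhp_regular S"
  shows "H2_ext_norm \<psi> q (\<lambda>s. F s - G s) = sqrt (axis_energy (\<lambda>s. R s - S s) / (2 * pi))"
  unfolding H2_ext_norm_def
proof (rule H2_rhp_norm_eq[OF rhp_regular_diff[OF RS] finite_poles])
  fix s assume s: "0 < Re s" "s \<notin> {s. is_pole \<psi> s}"
  then have "hfrak \<psi> q (\<lambda>s. F s - G s) s = hfrak \<psi> q F s - hfrak \<psi> q G s"
    by (simp add: hfrak_def algebra_simps)
  then show "hfrak \<psi> q (\<lambda>s. F s - G s) s = R s - S s" using F G s(1) by simp
qed

text \<open>Supplies the competitors for the minimizer. The points \<open>p i\<close> may coincide,
  so a displaced pole may collide with another one.\<close>

lemma partial_fractions_in_transfer_funs:
  fixes p \<phi> :: "'k::finite \<Rightarrow> complex"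
  assumes p: "\<And>i. p i \<in> X"
  shows "\<exists>G. G \<in> transfer_funs TYPE('k) \<and> G \<in> H2_ext \<psi> q A \<and>
    (\<forall>s. 0 < Re s \<longrightarrow> hfrak \<psi> q G s = (\<Sum>i\<in>UNIV. \<phi> i * (poly L (p i) / \<kappa>) * (1 / (s - p i))))"
proof -
  define G where "G = transfer_fun (\<chi> i j. if i = j then \<psi> (p i) else 0) (\<chi> i. \<phi> i) (\<chi> i. 1)"
  have pA: "\<psi> (p i) \<in> A" for i using p settingD(7) by auto
  have G: "G s = (\<Sum>i\<in>UNIV. \<phi> i / (s - \<psi> (p i)))" if "s \<notin> A" for s
    unfolding G_def by (rule transfer_fun_diagonal) (use that pA in auto)
  note hG = hfrak_partial_fractions[of p, OF p G]
  have "rhp_regular (\<lambda>s. \<Sum>i\<in>UNIV. \<phi> i * (poly L (p i) / \<kappa>) * (1 / (s - p i)))"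
    by (intro rhp_regular_sum rhp_regular_cmult rhp_regular_pole settingD(3) p)
  from rhp_regular_in_H2_rhp[OF this hG] have "hfrak \<psi> q G \<in> H2_rhp" .
  moreover have out: "s \<notin> A" if "s \<in> - closure A" for s using that closure_subset by blast
  have "(\<lambda>s. \<Sum>i\<in>UNIV. \<phi> i / (s - \<psi> (p i))) holomorphic_on - closure A"
    using pA out by (intro holomorphic_intros) auto
  then have "G holomorphic_on - closure A"
    using G[OF out] by (subst holomorphic_cong[OF refl]) auto
  ultimately have "G \<in> H2_ext \<psi> q A" by (simp add: H2_ext_def)
  moreover have "G \<in> transfer_funs TYPE('k)" by (auto simp: transfer_funs_def G_def)
  ultimately show ?thesis using hG by blast
qed

text \<open>Optimality says that subtracting the increment v from the error e does not lower the
  energy; expanding the energy of \<open>e - v\<close> leaves \<open>2 * Re\<close> of the inner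
  product of e and v bounded by the energy of v.\<close>

lemma variation_inequality:
  fixes p \<phi> :: "'k::finite \<Rightarrow> complex"
  assumes RH: "rhp_regular RH" "\<And>s. 0 < Re s \<Longrightarrow> hfrak \<psi> q H s = RH s"
    and p: "\<And>i. p i \<in> X"
    and Hr: "\<And>s. 0 < Re s \<Longrightarrow> hfrak \<psi> q Hr s = Rr s"
    and Rr: "Rr = (\<lambda>s. \<Sum>i\<in>UNIV. \<phi> i * (poly L (p i) / \<kappa>) * (1 / (s - p i)))"
    and min: "local_H2_minimizer \<psi> q A (transfer_funs TYPE('k)) H Hr"
    and \<beta>: "\<beta> = \<phi> j * (poly L (p j) / \<kappa>)"
  shows "\<exists>\<delta>>0. \<forall>p'\<in>X. \<forall>\<beta>'. axis_energy (pole_difference \<beta>' p' \<beta> (p j)) < \<delta> \<longrightarrow>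
     2 * Re (axis_inner (\<lambda>s. RH s - Rr s) (pole_difference \<beta>' p' \<beta> (p j)))
       \<le> axis_energy (pole_difference \<beta>' p' \<beta> (p j))"
proof -
  obtain \<epsilon> where \<epsilon>: "\<epsilon> > 0" "\<And>G. G \<in> transfer_funs TYPE('k) \<Longrightarrow> G \<in> H2_ext \<psi> q A \<Longrightarrow>
      H2_ext_norm \<psi> q (\<lambda>s. G s - Hr s) < \<epsilon> \<Longrightarrow>
      H2_ext_norm \<psi> q (\<lambda>s. H s - Hr s) \<le> H2_ext_norm \<psi> q (\<lambda>s. H s - G s)"
    using min unfolding local_H2_minimizer_def by blast
  have pole: "rhp_regular (\<lambda>s. c * (1 / (s - p')))" if "p' \<in> X" for p' c
    by (intro rhp_regular_cmult rhp_regular_pole settingD(3) that)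
  have Rr_reg: "rhp_regular Rr"
    unfolding Rr by (intro rhp_regular_sum pole p)
  show ?thesis
  \<comment> \<open>The norm is the square root of the energy divided by \<open>2 * pi\<close>, so
    this threshold matches the radius \<epsilon>.\<close>
  proof (intro exI[of _ "2 * pi * \<epsilon> ^ 2"] conjI ballI allI impI)
    show "2 * pi * \<epsilon> ^ 2 > 0" using \<epsilon>(1) by simp
    fix p' \<beta>'
    define v where "v = pole_difference \<beta>' p' \<beta> (p j)"
    assume p': "p' \<in> X" and "axis_energy (pole_difference \<beta>' p' \<beta> (p j)) < 2 * pi * \<epsilon> ^ 2"
    then have small: "axis_energy v < 2 * pi * \<epsilon> ^ 2" by (simp add: v_def)
    have v: "v = (\<lambda>s. \<beta>' * (1 / (s - p')) - \<beta> * (1 / (s - p j)))"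
      by (simp only: v_def pole_difference_def)
    define pp where "pp = p(j := p')"
    \<comment> \<open>The residue in the original variable whose transformed residue is
      \<beta>'.\<close>
    define ph where "ph = \<phi>(j := \<beta>' * \<kappa> / poly L p')"
    have L': "poly L p' \<noteq> 0" using nonpole_X[OF p'] pole_iff by blast
    have v_reg: "rhp_regular v"
      unfolding v by (intro rhp_regular_diff pole p' p)
    have ppX: "pp i \<in> X" for i using p p' by (simp add: pp_def)
    obtain G where G: "G \<in> transfer_funs TYPE('k)" "G \<in> H2_ext \<psi> q A"
      "\<And>s. 0 < Re s \<Longrightarrow> hfrak \<psi> q G s = (\<Sum>i\<in>UNIV. ph i * (poly L (pp i) / \<kappa>) * (1 / (s - pp i)))"
      using partial_fractions_in_transfer_funs[of pp ph, OF ppX] by blast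
    define RG where "RG s = Rr s + v s" for s
    have "(\<Sum>i\<in>UNIV. ph i * (poly L (pp i) / \<kappa>) * (1 / (s - pp i))) = RG s" for s
    proof -
      have "(\<Sum>i\<in>UNIV. ph i * (poly L (pp i) / \<kappa>) * (1 / (s - pp i)))
          = \<beta>' * (1 / (s - p')) + (\<Sum>i\<in>UNIV - {j}. \<phi> i * (poly L (p i) / \<kappa>) * (1 / (s - p i)))"
        using L' \<kappa> by (subst sum.remove[of _ j]) (auto simp: ph_def pp_def intro!: sum.cong)
      moreover have "Rr s = \<beta> * (1 / (s - p j)) + (\<Sum>i\<in>UNIV - {j}. \<phi> i * (poly L (p i) / \<kappa>) * (1 / (s - p i)))"
        unfolding Rr \<beta> by (subst sum.remove[of _ j]) auto
      ultimately show ?thesis by (simp add: RG_def v)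
    qed
    with G(3) have G3: "hfrak \<psi> q G s = RG s" if "0 < Re s" for s using that by simp
    have RG_reg: "rhp_regular RG"
      unfolding RG_def by (intro rhp_regular_add Rr_reg v_reg)
    have "H2_ext_norm \<psi> q (\<lambda>s. G s - Hr s) = sqrt (axis_energy v / (2 * pi))"
      using norm_diff_eq[of G RG Hr Rr, OF G3 Hr RG_reg Rr_reg] by (simp add: RG_def)
    moreover have "sqrt (axis_energy v / (2 * pi)) < \<epsilon>"
      using small \<epsilon>(1) by (intro real_less_lsqrt) (simp_all add: pos_divide_less_eq mult_ac)
    ultimately have "H2_ext_norm \<psi> q (\<lambda>s. H s - Hr s) \<le> H2_ext_norm \<psi> q (\<lambda>s. H s - G s)"
      by (intro \<epsilon>(2) G) simp
    moreover have "H2_ext_norm \<psi> q (\<lambda>s. H s - Hr s) = sqrt (axis_energy (\<lambda>s. RH s - Rr s) / (2 * pi))"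
      by (rule norm_diff_eq) (simp_all add: RH Hr Rr_reg)
    moreover have "H2_ext_norm \<psi> q (\<lambda>s. H s - G s) = sqrt (axis_energy (\<lambda>s. RH s - RG s) / (2 * pi))"
      by (rule norm_diff_eq) (simp_all add: RH G3 RG_reg)
    ultimately have "axis_energy (\<lambda>s. RH s - Rr s) \<le> axis_energy (\<lambda>s. RH s - RG s)"
      by (simp add: divide_le_cancel)
    moreover have "(\<lambda>s. RH s - RG s) = (\<lambda>s. (RH s - Rr s) - v s)"
      by (simp add: RG_def algebra_simps)
    ultimately show "2 * Re (axis_inner (\<lambda>s. RH s - Rr s) (pole_difference \<beta>' p' \<beta> (p j)))
        \<le> axis_energy (pole_difference \<beta>' p' \<beta> (p j))"
      using axis_energy_diff[OF rhp_regular_diff[OF RH(1) Rr_reg] v_reg] by (simp flip: v_def)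
  qed
qed

lemma axis_inner_two_poles:
  assumes R: "rhp_regular R" and p: "p \<in> X" "p' \<in> X"
  shows "axis_inner R (pole_difference a p b p')
    = 2 * pi * (a * cnj (R (- cnj p)) - b * cnj (R (- cnj p')))"
proof -
  note reg = rhp_regular_pole[OF settingD(3)[OF p(1)]] rhp_regular_pole[OF settingD(3)[OF p(2)]]
  have "axis_inner R (pole_difference a p b p')
      = a * axis_inner R (\<lambda>s. 1 / (s - p)) - b * axis_inner R (\<lambda>s. 1 / (s - p'))"
    unfolding axis_inner_def pole_difference_def right_diff_distrib mult.left_commute[of "cnj _"]
    using integrable_axis_inner[OF R reg(1)] integrable_axis_inner[OF R reg(2)]
    by (simp only: Bochner_Integration.integral_diff integrable_mult_right integral_mult_right_zero)
  then show ?thesis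
    unfolding axis_inner_pole[OF R settingD(3)[OF p(1)]] axis_inner_pole[OF R settingD(3)[OF p(2)]]
    by (simp add: algebra_simps)
qed

text \<open>By the reproducing formula, varying the residue tests the value of R at
  \<open>- cnj p\<close>. Once this is 0, moving the pole tests the derivative.\<close>

lemma vanishing_if_stationary:
  assumes R: "rhp_regular R" and p: "p \<in> X" and \<beta>: "\<beta> \<noteq> 0" and \<delta>: "\<delta> > 0"
    and stat: "\<forall>p'\<in>X. \<forall>\<beta>'. axis_energy (pole_difference \<beta>' p' \<beta> p) < \<delta> \<longrightarrow>
      2 * Re (axis_inner R (pole_difference \<beta>' p' \<beta> p)) \<le> axis_energy (pole_difference \<beta>' p' \<beta> p)"
  shows "R (- cnj p) = 0" "deriv R (- cnj p) = 0"
proof -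
  define u where "u = (\<lambda>s. 1 / (s - p))"
  define K where "K = axis_energy u"
  have u: "rhp_regular u" unfolding u_def by (rule rhp_regular_pole[OF settingD(3)[OF p]])
  have small: "eventually (\<lambda>t. C * cmod t ^ 2 < \<delta>) (nhds 0)" for C
  proof (rule order_tendstoD(2)[OF _ \<delta>])
    show "((\<lambda>t. C * cmod t ^ 2) \<longlongrightarrow> 0) (nhds 0)"
      by (auto intro!: tendsto_eq_intros filterlim_ident)
  qed
  have E: "axis_energy (\<lambda>s. t * u s) \<le> cmod t ^ 2 * K" for t
    unfolding K_def by (rule axis_energy_mono[OF rhp_regular_cmult[OF u] u]) (simp add: norm_mult)
  define c where "c = 4 * pi * cnj (R (- cnj p))"
  have "c = 0"
  proof (rule derivative_zero_if_Re_le_square)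
    show "((\<lambda>t. t * c) has_field_derivative c) (at 0)" by (auto intro!: derivative_eq_intros)
    show "eventually (\<lambda>t. Re (t * c) \<le> K * cmod t ^ 2) (nhds 0)"
      using small[of K]
    proof eventually_elim
      case (elim t)
      have v: "(\<lambda>s. t * u s) = pole_difference (\<beta> + t) p \<beta> p"
        by (simp add: u_def pole_difference_def add_divide_distrib fun_eq_iff)
      have "2 * Re (axis_inner R (\<lambda>s. t * u s)) \<le> axis_energy (\<lambda>s. t * u s)"
        unfolding v by (rule stat[rule_format, OF p])
          (use E[of t] elim in \<open>simp add: mult.commute flip: v\<close>)
      moreover have "2 * axis_inner R (\<lambda>s. t * u s) = t * c"
        unfolding v axis_inner_two_poles[OF R p p] c_def by (simp add: algebra_simps)
      from arg_cong[OF this, of Re] have "2 * Re (axis_inner R (\<lambda>s. t * u s)) = Re (t * c)"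
        by simp
      ultimately show ?case using E[of t] by (simp add: mult.commute)
    qed
  qed simp
  then show R0: "R (- cnj p) = 0" by (simp add: c_def)
  define a where "a = - Re p"
  have a: "a > 0" using settingD(3)[OF p] by (simp add: a_def)
  \<comment> \<open>Twice the inner product with the increment when the pole moves to
    \<open>p + t\<close>; the term of the old pole is gone as R vanishes there. The double
    conjugation makes f holomorphic in t.\<close>
  define f where "f t = 4 * pi * \<beta> * cnj (R (- cnj p - cnj t))" for t
  have "R analytic_on {- cnj p}"
    using R a by (auto simp: rhp_regular_def a_def intro: analytic_on_subset)
  then have dR: "(R has_field_derivative deriv R (- cnj p)) (at (- cnj p))"
    by (simp add: analytic_on_imp_differentiable_at field_differentiable_derivI)
  have "((cnj \<circ> R \<circ> cnj) has_field_derivative cnj (deriv R (- cnj p))) (at (- p - 0))"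
    by (rule has_field_derivative_cnj_cnj) (use dR in simp)
  then have "((\<lambda>t. (cnj \<circ> R \<circ> cnj) (- p - t)) has_field_derivative cnj (deriv R (- cnj p)) * (- 1)) (at 0)"
    by (rule DERIV_chain2) (auto intro!: derivative_eq_intros)
  from DERIV_cmult[OF this, of "4 * pi * \<beta>"]
  have df: "(f has_field_derivative 4 * pi * \<beta> * (cnj (deriv R (- cnj p)) * (- 1))) (at 0)"
    by (simp add: f_def[abs_def])
  have "4 * pi * \<beta> * (cnj (deriv R (- cnj p)) * (- 1)) = 0"
  proof (rule derivative_zero_if_Re_le_square[OF df])
    show "f 0 = 0" using R0 by (simp add: f_def)
    \<comment> \<open>The increment equals \<open>\<beta> * t / (s - (p + t))\<close> times the old
      kernel, and for \<open>cmod t < a / 2\<close> the moved pole keeps distance at least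
      \<open>a / 2\<close> from the axis.\<close>
    define C where "C = (cmod \<beta> * 2 / a) ^ 2 * K"
    obtain e where e: "e > 0" "ball p e \<subseteq> X" using settingD(2) p openE by blast
    have "eventually (\<lambda>t::complex. t \<in> ball 0 (min e (a / 2))) (nhds 0)"
      using e a by (intro eventually_nhds_in_open) auto
    with small[of C] show "eventually (\<lambda>t. Re (f t) \<le> C * cmod t ^ 2) (nhds 0)"
    proof eventually_elim
      case (elim t)
      then have t: "cmod t < e" "cmod t < a / 2" by auto
      have p': "p + t \<in> X" using e(2) t(1) by (auto simp: dist_norm)
      define v where "v = pole_difference \<beta> (p + t) \<beta> p"
      have v_reg: "rhp_regular v"
        unfolding v_def pole_difference_def
        by (intro rhp_regular_diff rhp_regular_cmult rhp_regular_pole settingD(3) p p')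
      have "axis_energy v \<le> (cmod \<beta> * cmod t * 2 / a) ^ 2 * axis_energy u"
      proof (rule axis_energy_mono[OF v_reg u])
        fix s :: complex assume s: "Re s = 0"
        have "a \<le> cmod (s - p)" using abs_Re_le_cmod[of "s - p"] s by (simp add: a_def)
        moreover have "cmod (s - p) \<le> cmod (s - (p + t)) + cmod t"
          using norm_triangle_ineq[of "s - (p + t)" t] by simp
        ultimately have far: "a / 2 \<le> cmod (s - (p + t))" using t by linarith
        then have nz: "s - (p + t) \<noteq> 0" "s - p \<noteq> 0" using a \<open>a \<le> cmod (s - p)\<close> by auto
        then have "v s = \<beta> * t / (s - (p + t)) * u s"
          by (simp add: v_def pole_difference_def u_def divide_simps) (simp add: algebra_simps)
        then have "cmod (v s) = cmod \<beta> * cmod t / cmod (s - (p + t)) * cmod (u s)"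
          by (simp add: norm_mult norm_divide)
        also have "\<dots> \<le> cmod \<beta> * cmod t / (a / 2) * cmod (u s)"
          using far a by (intro mult_right_mono divide_left_mono mult_pos_pos) (auto simp: nz)
        finally show "cmod (v s) \<le> cmod \<beta> * cmod t * 2 / a * cmod (u s)" by simp
      qed
      also have "\<dots> = C * cmod t ^ 2"
        by (simp add: C_def K_def power_mult_distrib power_divide)
      finally have Ev: "axis_energy v \<le> C * cmod t ^ 2" .
      then have "2 * Re (axis_inner R v) \<le> axis_energy v"
        using elim stat p' by (auto simp: v_def)
      moreover have "2 * axis_inner R v = f t"
        unfolding v_def axis_inner_two_poles[OF R p' p] using R0 by (simp add: f_def algebra_simps)
      from arg_cong[OF this, of Re] have "2 * Re (axis_inner R v) = Re (f t)"
        by simp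
      ultimately show ?case using Ev by simp
    qed
  qed
  then show "deriv R (- cnj p) = 0" using \<beta> by simp
qed

lemma first_order_conditions:
  fixes l \<phi> :: "'k::finite \<Rightarrow> complex"
  assumes H: "H \<in> H2_ext \<psi> q A" "rational_fun H"
    and l: "\<And>i. l i \<in> A" and \<phi>: "\<phi> j \<noteq> 0"
    and Hr: "\<And>s. s \<notin> range l \<Longrightarrow> Hr s = (\<Sum>i\<in>UNIV. \<phi> i / (s - l i))"
    and min: "local_H2_minimizer \<psi> q A (transfer_funs TYPE('k)) H Hr"
    and w: "w = - cnj (psi_inv \<psi> X (l j))"
  shows "hfrak \<psi> q Hr w = hfrak \<psi> q H w \<and> deriv (hfrak \<psi> q Hr) w = deriv (hfrak \<psi> q H) w"
proof -
  define p where "p i = psi_inv \<psi> X (l i)" for i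
  have p: "p i \<in> X" "\<psi> (p i) = l i" for i
    using psi_inv_facts[OF setting l] by (simp_all add: p_def)
  define Rr where "Rr = (\<lambda>s. \<Sum>i\<in>UNIV. \<phi> i * (poly L (p i) / \<kappa>) * (1 / (s - p i)))"
  have "Hr s = (\<Sum>i\<in>UNIV. \<phi> i / (s - \<psi> (p i)))" if "s \<notin> A" for s
    unfolding p(2) by (rule Hr) (use that l in auto)
  then have hHr: "hfrak \<psi> q Hr s = Rr s" if "0 < Re s" for s
    unfolding Rr_def using hfrak_partial_fractions[of p Hr \<phi> s] p(1) that by blast
  obtain RH where RH: "rhp_regular RH" "\<And>s. 0 < Re s \<Longrightarrow> hfrak \<psi> q H s = RH s"
    using hfrak_rational[OF H] by blast
  define \<beta> where "\<beta> = \<phi> j * (poly L (p j) / \<kappa>)"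
  have \<beta>: "\<beta> \<noteq> 0" using \<phi> \<kappa> nonpole_X[OF p(1), of j] pole_iff by (simp add: \<beta>_def)
  have Rr_reg: "rhp_regular Rr"
    unfolding Rr_def by (intro rhp_regular_sum rhp_regular_cmult rhp_regular_pole settingD(3) p)
  have "\<exists>\<delta>>0. \<forall>p'\<in>X. \<forall>\<beta>'. axis_energy (pole_difference \<beta>' p' \<beta> (p j)) < \<delta> \<longrightarrow>
     2 * Re (axis_inner (\<lambda>s. RH s - Rr s) (pole_difference \<beta>' p' \<beta> (p j)))
       \<le> axis_energy (pole_difference \<beta>' p' \<beta> (p j))"
    by (rule variation_inequality[of RH H p Hr Rr \<phi> \<beta> j]) (simp_all add: RH p(1) hHr Rr_def min \<beta>_def)
  then obtain \<delta> where \<delta>: "\<delta> > 0" "\<forall>p'\<in>X. \<forall>\<beta>'. axis_energy (pole_difference \<beta>' p' \<beta> (p j)) < \<delta> \<longrightarrow>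
     2 * Re (axis_inner (\<lambda>s. RH s - Rr s) (pole_difference \<beta>' p' \<beta> (p j)))
       \<le> axis_energy (pole_difference \<beta>' p' \<beta> (p j))"
    by blast
  note van = vanishing_if_stationary[OF rhp_regular_diff[OF RH(1) Rr_reg] p(1)[of j] \<beta> \<delta>]
  have wp: "w = - cnj (p j)" by (simp add: w p_def)
  then have Rew: "0 < Re w" using settingD(3)[OF p(1), of j] by simp
  have ev: "eventually (\<lambda>s. 0 < Re s) (nhds w)"
    using eventually_nhds_in_open[OF open_halfspace_Re_gt, of w 0] Rew by simp
  have "eventually (\<lambda>s. hfrak \<psi> q Hr s = Rr s) (nhds w)" "eventually (\<lambda>s. hfrak \<psi> q H s = RH s) (nhds w)"
    using ev by (auto elim!: eventually_mono simp: hHr RH(2))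
  then have dh: "deriv (hfrak \<psi> q Hr) w = deriv Rr w" "deriv (hfrak \<psi> q H) w = deriv RH w"
    by (auto intro: deriv_cong_ev)
  have "RH field_differentiable at w" "Rr field_differentiable at w"
    using RH(1) Rr_reg Rew by (auto simp: rhp_regular_def intro: analytic_on_imp_differentiable_at)
  then have "deriv (\<lambda>s. RH s - Rr s) w = deriv RH w - deriv Rr w" by (rule deriv_diff)
  then show ?thesis using van[folded wp] dh hHr[OF Rew] RH(2)[OF Rew] by simp
qed

end

lemma hfrak_first_order_conditions:
  fixes l \<phi> :: "'k::finite \<Rightarrow> complex"
  assumes setting: "conformal_setting \<psi> X A" and root: "sqrt_deriv \<psi> q" "q analytic_on X"
    and regular: "residue_regular \<psi> q X A"
    and H: "H \<in> H2_ext \<psi> q A" "rational_fun H"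
    and l: "\<And>i. l i \<in> A" and \<phi>: "\<phi> j \<noteq> 0"
    and Hr: "\<And>s. s \<notin> range l \<Longrightarrow> Hr s = (\<Sum>i\<in>UNIV. \<phi> i / (s - l i))"
    and min: "local_H2_minimizer \<psi> q A (transfer_funs TYPE('k)) H Hr"
    and w: "w = - cnj (psi_inv \<psi> X (l j))"
  shows "hfrak \<psi> q Hr w = hfrak \<psi> q H w \<and> deriv (hfrak \<psi> q Hr) w = deriv (hfrak \<psi> q H) w"
proof -
  have reg: "regular_setting \<psi> q X A"
    by (intro regular_setting.intro setting root regular)
  \<comment> \<open>Any point of X can serve as base point of the Moebius form.\<close>
  have "psi_inv \<psi> X (l j) \<in> X" by (rule psi_inv_facts(1)[OF setting l])
  then obtain L N \<kappa> where "moebius_setting \<psi> q X A L N \<kappa>"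
    using regular_setting.moebius_form[OF reg] by blast
  then show ?thesis
    by (rule moebius_setting.first_order_conditions[OF _ H l \<phi> Hr min w])
qed

theorem corollary4p2:
  fixes A X \<Gamma> :: "complex set" and \<psi> q :: "complex \<Rightarrow> complex"
    and M :: "complex^'n^'n" and b c :: "complex^'n"
    and H Hr :: "complex \<Rightarrow> complex"
    and l \<phi> :: "'r::finite \<Rightarrow> complex"
  assumes A: "A \<noteq> {}" "connected A" "open A"
    and setting: "conformal_setting \<psi> X A"
    and root: "sqrt_deriv \<psi> q" "q analytic_on X"
    and poles_q: "\<Gamma> = {z. Re z < 0 \<and> is_pole q z}" "finite \<Gamma>"
      "\<And>\<gamma>. \<gamma> \<in> \<Gamma> \<Longrightarrow> simple_pole q \<gamma>"
      "\<And>\<gamma>. \<gamma> \<in> \<Gamma> \<Longrightarrow> value_in_exterior \<psi> A \<gamma>"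
    and same_poles: "{z. is_pole \<psi> z} = {z. is_pole q z}"
    and FOM: "H = transfer_fun M b c" "H \<in> H2_ext \<psi> q A"
    and order: "CARD('r) < CARD('n)"
    and ROM: "Hr \<in> transfer_funs TYPE('r)" "Hr \<in> H2_ext \<psi> q A"
      "inj l" "\<And>j. l j \<in> A" "\<And>j. \<phi> j \<noteq> 0"
      "\<And>s. s \<notin> range l \<Longrightarrow> Hr s = (\<Sum>j\<in>UNIV. \<phi> j / (s - l j))"
    and minimizer: "local_H2_minimizer \<psi> q A (transfer_funs TYPE('r)) H Hr"
    and no_pole: "\<And>j. \<not> is_pole q (psi_inv \<psi> X (l j))" "\<And>j. \<not> is_pole \<psi> (psi_inv \<psi> X (l j))"
    and deriv_nz: "\<And>j. \<exists>N. open N \<and> - psi_inv \<psi> X (l j) \<in> N \<and>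
      (\<forall>s\<in>N. \<psi> field_differentiable at (cnj s) \<and> cbar (deriv \<psi>) s \<noteq> 0)"
  shows "(\<forall>j.
            (frakF \<psi> q X \<Gamma> Hr (l j) = frakF \<psi> q X \<Gamma> H (l j) \<and>
             deriv (frakF \<psi> q X \<Gamma> Hr) (l j) = deriv (frakF \<psi> q X \<Gamma> H) (l j))
            \<longleftrightarrow>
            (Hr (phi \<psi> X (l j)) = H (phi \<psi> X (l j)) \<and>
             deriv Hr (phi \<psi> X (l j)) = deriv H (phi \<psi> X (l j)))) \<and>
         (residue_regular \<psi> q X A \<longrightarrow>
           (\<forall>j.
             frakF \<psi> q X \<Gamma> Hr (l j) = frakF \<psi> q X \<Gamma> H (l j) \<and>
             deriv (frakF \<psi> q X \<Gamma> Hr) (l j) = deriv (frakF \<psi> q X \<Gamma> H) (l j) \<and>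
             Hr (phi \<psi> X (l j)) = H (phi \<psi> X (l j)) \<and>
             deriv Hr (phi \<psi> X (l j)) = deriv H (phi \<psi> X (l j))))"
proof -
  note C = conformal_settingD[OF setting]
  define w where "w j = - cnj (psi_inv \<psi> X (l j))" for j
  have z: "psi_inv \<psi> X (l j) \<in> X" for j
    using psi_inv_facts(1)[OF setting ROM(4)] .
  have w: "0 < Re (w j)" "\<psi> analytic_on {w j}" "deriv \<psi> (w j) \<noteq> 0" "\<psi> (w j) \<in> - closure A" for j
    using C(3,8,9,10)[OF z[of j]] by (simp_all add: w_def)
  have phi: "phi \<psi> X (l j) = \<psi> (w j)" for j
    by (simp add: phi_def cbar_def w_def)
  note dr = H2_ext_field_differentiable[OF ROM(2)]
  note dH = H2_ext_field_differentiable[OF FOM(2)]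
  have frak: "frakF \<psi> q X \<Gamma> Hr (l j) = frakF \<psi> q X \<Gamma> H (l j) \<and>
      deriv (frakF \<psi> q X \<Gamma> Hr) (l j) = deriv (frakF \<psi> q X \<Gamma> H) (l j) \<longleftrightarrow>
      hfrak \<psi> q Hr (w j) = hfrak \<psi> q H (w j) \<and>
      deriv (hfrak \<psi> q Hr) (w j) = deriv (hfrak \<psi> q H) (w j)" for j
    using hermite_frakF_iff[OF setting root same_poles ROM(4) w_def dr(1)[OF w(1)] dH(1)[OF w(1)]] .
  have hf: "hfrak \<psi> q Hr (w j) = hfrak \<psi> q H (w j) \<and>
      deriv (hfrak \<psi> q Hr) (w j) = deriv (hfrak \<psi> q H) (w j) \<longleftrightarrow>
      Hr (phi \<psi> X (l j)) = H (phi \<psi> X (l j)) \<and>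
      deriv Hr (phi \<psi> X (l j)) = deriv H (phi \<psi> X (l j))" for j
    unfolding phi
    by (intro hermite_hfrak_iff root(1) w(2,3) dr(1)[OF w(1)] dH(1)[OF w(1)] dr(2)[OF w(4)] dH(2)[OF w(4)])
  \<comment> \<open>The two sets of conditions are equivalent by \<open>frak\<close> and
    \<open>hf\<close> alone; regularity enters when they are derived from minimality.\<close>
  have stationary: "hfrak \<psi> q Hr (w j) = hfrak \<psi> q H (w j) \<and>
      deriv (hfrak \<psi> q Hr) (w j) = deriv (hfrak \<psi> q H) (w j)" if "residue_regular \<psi> q X A" for j
    by (rule hfrak_first_order_conditions[OF setting root that FOM(2) _ ROM(4) ROM(5) ROM(6) minimizer w_def])
       (simp only: FOM(1) rational_fun_transfer_fun)
  show ?thesis using frak hf stationary by blast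
qed

end
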